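(* Let $A$ be a finite alphabet of colors and $J$ a sentence over $A$. Then $\psi(\mathfrak{S}^*_J)=\mathfrak{RS}^*_J$.
   Context: Words are finite sequences of colors; a sentence is a finite sequence $I=(w_1,\dots,w_k)$ of nonempty words; $w(I)=w_1\cdots w_k$. $J\preceq I$ means $w(J)=w(I)$ and $I$ arises from $J$ by concatenating adjacent words. A sentence splits after its $i$-th letter if the $i$-th and $(i+1)$-th letters lie in different words; the complement $I^c$ is the unique sentence with $w(I^c)=w(I)$ splitting exactly at the positions where $I$ does not. Variables $x_{a,i}$ ($a\in A$, $i\ge1$) satisfy only $x_{a,i}x_{b,j}=x_{b,j}x_{a,i}$ for $i\ne j$; $x_{w,i}=x_{c_1,i}\cdots x_{c_r,i}$, $x_{\emptyset,i}=1$. $M_I=\sum_{j_1<\dots<j_k}x_{w_1,j_1}\cdots x_{w_k,j_k}$, $QSym_A=\mathrm{span}\{M_I\}$, $F_I=\sum_{J\preceq I}M_J$. $\psi:QSym_A\to QSym_A$ is the linear map with $\psi(F_I)=F_{I^c}$. For $J=(w_1,\dots,w_k)$ the colored composition diagram has $k$ left-justified rows (row 1 on top), row $i$ with $|w_i|$ boxes colored in order by the letters of $w_i$. A colored immaculate tableau (CIT) of shape $J$ fills it with positive integers weakly increasing left to right in rows and strictly increasing top to bottom in the first column; its type is $(u_1,\dots,u_m)$ with $u_i$ the colors of boxes containing $i$ read from the lowest row to the highest, left to right within rows; $x_T=x_{u_1,1}\cdots x_{u_m,m}$; $\mathfrak{S}^*_J=\sum_T x_T$ over all CIT of shape $J$.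 A colored row-strict immaculate tableau (CRSIT) of shape $J$ fills the diagram with positive integers strictly increasing left to right in each row and weakly increasing top to bottom in the first column; its type is $(u_1,\dots,u_m)$ with $u_i$ the colors of the boxes containing $i$ read left to right and top to bottom (rows from top to bottom); $x_T=x_{u_1,1}\cdots x_{u_m,m}$. The colored row-strict dual immaculate function is $\mathfrak{RS}^*_J=\sum_T x_T$ over all CRSIT of shape $J$. *)

theory Defs
  imports Complex_Main "HOL-Library.Function_Algebras"
begin

section \<open>Words and sentences\<close>

definition sentences :: "'a set \<Rightarrow> 'a list list set" where
  "sentences A = lists (lists A - {[]})"

text \<open>\<^term>\<open>refines J I\<close> is \<open>J \<preceq> I\<close>: each word of \<open>I\<close> is the concatenation of one of
  the consecutive groups \<open>G\<close> of words of \<open>J\<close>.\<close>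

definition refines :: "'a list list \<Rightarrow> 'a list list \<Rightarrow> bool" where
  "refines J I \<longleftrightarrow> [] \<notin> set J \<and> concat J = concat I \<and>
     (\<exists>G. concat G = J \<and> map concat G = I)"

text \<open>Letter positions are counted from 1, words of a sentence from 0.\<close>

definition letter_in_word :: "'a list list \<Rightarrow> nat \<Rightarrow> nat \<Rightarrow> bool" where
  "letter_in_word I i k \<longleftrightarrow> k < length I \<and>
     length (concat (take k I)) < i \<and> i \<le> length (concat (take (Suc k) I))"

definition splits_after :: "'a list list \<Rightarrow> nat \<Rightarrow> bool" where
  "splits_after I i \<longleftrightarrow>
     (\<exists>k l. letter_in_word I i k \<and> letter_in_word I (Suc i) l \<and> k \<noteq> l)"

definition complement :: "'a list list \<Rightarrow> 'a list list" where
  "complement I = (THE K. [] \<notin> set K \<and> concat K = concat I \<and>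
     (\<forall>i. 1 \<le> i \<and> i < length (concat I) \<longrightarrow> (splits_after K i \<longleftrightarrow> \<not> splits_after I i)))"


section \<open>Monomials in partially commuting variables\<close>

text \<open>The monoid presented by generators \<open>x\<^bsub>a,i\<^esub>\<close>, represented by pairs \<open>(a, i)\<close>, and the
  relations \<open>x\<^bsub>a,i\<^esub> x\<^bsub>b,j\<^esub> = x\<^bsub>b,j\<^esub> x\<^bsub>a,i\<^esub>\<close> for \<open>i \<noteq> j\<close>. Generators with \<open>i = 0\<close> exist in the
  type but are never used: all sums below range over indices \<open>\<ge> 1\<close>.\<close>

inductive pc_step :: "('a \<times> nat) list \<Rightarrow> ('a \<times> nat) list \<Rightarrow> bool" where
  swap: "i \<noteq> j \<Longrightarrow> pc_step (u @ [(a, i), (b, j)] @ v) (u @ [(b, j), (a, i)] @ v)"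

definition pc_eq :: "('a \<times> nat) list \<Rightarrow> ('a \<times> nat) list \<Rightarrow> bool" where
  "pc_eq = pc_step\<^sup>*\<^sup>*"

lemma pc_step_sym: "pc_step u v \<Longrightarrow> pc_step v u"
  by (induction rule: pc_step.induct) (rule pc_step.swap, rule not_sym)

lemma pc_step_append: "pc_step u v \<Longrightarrow> pc_step (p @ u @ q) (p @ v @ q)"
proof (induction rule: pc_step.induct)
  case (swap i j u a b v)
  then show ?case using pc_step.swap[of i j "p @ u" a b "v @ q"] by simp
qed

lemma pc_eq_sym: "pc_eq u v \<Longrightarrow> pc_eq v u"
proof -
  have "symp pc_step" by (auto intro: sympI pc_step_sym)
  then show "pc_eq u v \<Longrightarrow> pc_eq v u"
    unfolding pc_eq_def by (meson symp_rtranclp sympD)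
qed

lemma pc_eq_append:
  assumes "pc_eq u u'" "pc_eq v v'"
  shows "pc_eq (u @ v) (u' @ v')"
proof -
  have 1: "pc_step\<^sup>*\<^sup>* (p @ x @ q) (p @ y @ q)" if "pc_step\<^sup>*\<^sup>* x y" for x y p q :: "('a \<times> nat) list"
    using that
  proof (induction rule: rtranclp_induct)
    case (step y z)
    then show ?case using pc_step_append by (metis rtranclp.rtrancl_into_rtrancl)
  qed simp
  show ?thesis
    using assms 1[of u u' "[]" v] 1[of v v' u' "[]"] unfolding pc_eq_def by simp
qed

quotient_type 'a pcmon = "('a \<times> nat) list" / pc_eq
proof (rule equivpI)
  show "reflp pc_eq" by (auto simp: pc_eq_def intro: reflpI)
  show "symp pc_eq" by (auto intro: sympI pc_eq_sym)
  show "transp pc_eq" by (auto simp: pc_eq_def intro: transpI)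
qed

instantiation pcmon :: (type) monoid_mult
begin

lift_definition one_pcmon :: "'a pcmon" is "[]" .

lift_definition times_pcmon :: "'a pcmon \<Rightarrow> 'a pcmon \<Rightarrow> 'a pcmon" is "(@)"
  by (rule pc_eq_append)

instance
  by standard (transfer; simp add: pc_eq_def)+

end

lift_definition var :: "'a \<Rightarrow> nat \<Rightarrow> 'a pcmon" is "\<lambda>a i. [(a, i)]" .

lemma var_commute: "i \<noteq> j \<Longrightarrow> var a i * var b j = var b j * var a i"
proof transfer
  fix i j :: nat and a b :: 'a
  assume "i \<noteq> j"
  then have "pc_step ([] @ [(a, i), (b, j)] @ []) ([] @ [(b, j), (a, i)] @ [])"
    by (rule pc_step.swap)
  then show "pc_eq ([(a, i)] @ [(b, j)]) ([(b, j)] @ [(a, i)])"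
    by (simp add: pc_eq_def r_into_rtranclp)
qed

definition xword :: "'a list \<Rightarrow> nat \<Rightarrow> 'a pcmon" where
  "xword w i = prod_list (map (\<lambda>c. var c i) w)"


section \<open>Formal series and colored quasisymmetric functions\<close>

text \<open>A formal series is its coefficient function. Addition is the pointwise one from
  \<^theory>\<open>HOL-Library.Function_Algebras\<close>; the pointwise product of that theory is not used.\<close>

type_synonym ('a, 'k) series = "'a pcmon \<Rightarrow> 'k"

definition sscale :: "'k \<Rightarrow> ('a, 'k) series \<Rightarrow> ('a, 'k::comm_ring_1) series" where
  "sscale c f = (\<lambda>m. c * f m)"

interpretation series: module "sscale :: 'k::comm_ring_1 \<Rightarrow> ('a, 'k) series \<Rightarrow> ('a, 'k) series"
  by standard (auto simp: sscale_def fun_eq_iff algebra_simps)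

text \<open>The formal sum \<open>\<Sum>t\<in>T. x t\<close> of monomials. It is used only for families in which every
  monomial occurs finitely often; see the finiteness lemmas below.\<close>

definition formal_sum :: "'t set \<Rightarrow> ('t \<Rightarrow> 'a pcmon) \<Rightarrow> ('a, 'k::comm_ring_1) series" where
  "formal_sum T x = (\<lambda>m. of_nat (card {t \<in> T. x t = m}))"

definition index_seqs :: "nat \<Rightarrow> nat list set" where
  "index_seqs k = {js. length js = k \<and> sorted_wrt (<) js \<and> (\<forall>j\<in>set js. 1 \<le> j)}"

definition qsym_M :: "'a list list \<Rightarrow> ('a, 'k::comm_ring_1) series" where
  "qsym_M I = formal_sum (index_seqs (length I)) (\<lambda>js. prod_list (map2 xword I js))"

definition QSym :: "'a set \<Rightarrow> ('a, 'k::comm_ring_1) series set" where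
  "QSym A = series.span (qsym_M ` sentences A)"

definition qsym_F :: "'a list list \<Rightarrow> ('a, 'k::comm_ring_1) series" where
  "qsym_F I = (\<Sum>J | refines J I. qsym_M J)"

text \<open>\<open>\<psi>\<close> as a function with domain exactly \<open>QSym\<^sub>A\<close> (\<^const>\<open>undefined\<close> elsewhere).\<close>

definition qsym_psi :: "'a set \<Rightarrow> ('a, 'k::comm_ring_1) series \<Rightarrow> ('a, 'k) series" where
  "qsym_psi A = (THE \<psi>.
     (\<forall>f\<in>QSym A. \<psi> f \<in> QSym A) \<and> (\<forall>f. f \<notin> QSym A \<longrightarrow> \<psi> f = undefined) \<and>
     (\<forall>f\<in>QSym A. \<forall>g\<in>QSym A. \<psi> (f + g) = \<psi> f + \<psi> g) \<and>
     (\<forall>c. \<forall>f\<in>QSym A. \<psi> (sscale c f) = sscale c (\<psi> f)) \<and>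
     (\<forall>I\<in>sentences A. \<psi> (qsym_F I) = qsym_F (complement I)))"


section \<open>Colored immaculate tableaux\<close>

text \<open>A tableau of shape \<open>J\<close> is the list of its rows of entries, row 1 (the top row) first;
  the box in column \<open>c\<close> of row \<open>r\<close> has color \<open>J ! r ! c\<close>.\<close>

definition fillings :: "'a list list \<Rightarrow> nat list list set" where
  "fillings J = {T. map length T = map length J \<and> (\<forall>r\<in>set T. \<forall>e\<in>set r. 1 \<le> e)}"

definition CIT :: "'a list list \<Rightarrow> nat list list set" where
  "CIT J = {T \<in> fillings J. (\<forall>r\<in>set T. sorted_wrt (\<le>) r) \<and> sorted_wrt (<) (map hd T)}"

definition CRSIT :: "'a list list \<Rightarrow> nat list list set" where
  "CRSIT J = {T \<in> fillings J. (\<forall>r\<in>set T. sorted_wrt (<) r) \<and> sorted_wrt (\<le>) (map hd T)}"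

definition row_colors :: "nat \<Rightarrow> 'a list \<Rightarrow> nat list \<Rightarrow> 'a list" where
  "row_colors i w r = map fst (filter (\<lambda>(c, e). e = i) (zip w r))"

definition CIT_type :: "'a list list \<Rightarrow> nat list list \<Rightarrow> nat \<Rightarrow> 'a list" where
  "CIT_type J T i = concat (rev (map2 (row_colors i) J T))"

definition CRSIT_type :: "'a list list \<Rightarrow> nat list list \<Rightarrow> nat \<Rightarrow> 'a list" where
  "CRSIT_type J T i = concat (map2 (row_colors i) J T)"

definition max_entry :: "nat list list \<Rightarrow> nat" where
  "max_entry T = Max (insert 0 (set (concat T)))"

text \<open>\<open>x\<^bsub>u\<^sub>1,1\<^esub> \<dots> x\<^bsub>u\<^sub>m,m\<^esub>\<close> for a type \<open>(u\<^sub>1, \<dots>, u\<^sub>m)\<close>\<close>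

definition type_monomial :: "(nat \<Rightarrow> 'a list) \<Rightarrow> nat \<Rightarrow> 'a pcmon" where
  "type_monomial u m = prod_list (map (\<lambda>i. xword (u i) i) [1..<Suc m])"

definition dual_immaculate :: "'a list list \<Rightarrow> ('a, 'k::comm_ring_1) series" where
  "dual_immaculate J = formal_sum (CIT J) (\<lambda>T. type_monomial (CIT_type J T) (max_entry T))"

definition row_strict_dual_immaculate :: "'a list list \<Rightarrow> ('a, 'k::comm_ring_1) series" where
  "row_strict_dual_immaculate J =
     formal_sum (CRSIT J) (\<lambda>T. type_monomial (CRSIT_type J T) (max_entry T))"


section \<open>Well-definedness of the sums\<close>

lift_definition indices :: "'a pcmon \<Rightarrow> nat set" is "\<lambda>u. snd ` set u"
proof -
  fix u v :: "('a \<times> nat) list"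
  assume "pc_eq u v"
  then show "snd ` set u = snd ` set v"
    unfolding pc_eq_def by (induction rule: rtranclp_induct) (auto elim!: pc_step.cases)
qed

lemma finite_indices: "finite (indices m)"
  by transfer simp

lemma indices_one [simp]: "indices 1 = {}"
  by transfer simp

lemma indices_mult [simp]: "indices (m * n) = indices m \<union> indices n"
  by transfer auto

lemma indices_var [simp]: "indices (var a i) = {i}"
  by transfer simp

lemma indices_prod_list: "indices (prod_list ms) = (\<Union>m\<in>set ms. indices m)"
  by (induction ms) auto

lemma indices_xword: "indices (xword w i) = (if w = [] then {} else {i})"
  by (auto simp: xword_def indices_prod_list)

lemma finite_M_fibre:
  assumes "[] \<notin> set I"
  shows "finite {js \<in> index_seqs (length I). prod_list (map2 xword I js) = m}"
proof (rule finite_subset)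
  show "finite {js. set js \<subseteq> indices m \<and> length js = length I}"
    by (rule finite_lists_length_eq[OF finite_indices])
  show "{js \<in> index_seqs (length I). prod_list (map2 xword I js) = m}
      \<subseteq> {js. set js \<subseteq> indices m \<and> length js = length I}"
  proof safe
    fix js j
    assume js: "js \<in> index_seqs (length I)" and j: "j \<in> set js"
    then have len: "length js = length I" by (simp add: index_seqs_def)
    obtain n where n: "n < length js" "j = js ! n" using j by (auto simp: in_set_conv_nth)
    then have "I ! n \<noteq> []" using assms len by (metis nth_mem)
    moreover have "(I ! n, j) \<in> set (zip I js)" using n len by (auto simp: set_zip)
    then have "indices (xword (I ! n) j) \<subseteq> indices (prod_list (map2 xword I js))"
      unfolding indices_prod_list set_map by (intro UN_upper) (rule image_eqI, simp_all)
    ultimately show "j \<in> indices (prod_list (map2 xword I js))"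
      by (simp add: indices_xword)
  qed (simp add: index_seqs_def)
qed

lemma finite_refinements: "finite {J. refines J I}"
proof (rule finite_subset)
  let ?n = "length (concat I)"
  let ?W = "{w. set w \<subseteq> set (concat I) \<and> length w \<le> ?n}"
  show "finite {J. set J \<subseteq> ?W \<and> length J \<le> ?n}"
    by (intro finite_lists_length_le) simp
  have 1: "length J \<le> length (concat J)" if "[] \<notin> set J" for J :: "'a list list"
    using that
  proof (induction J)
    case (Cons a J)
    then show ?case by (cases a) auto
  qed simp
  have 2: "length w \<le> length (concat J)" if "w \<in> set J" for w :: "'a list" and J
    using that by (induction J) auto
  have 3: "set w \<subseteq> set (concat J)" if "w \<in> set J" for w :: "'a list" and J
    using that by auto
  show "{J. refines J I} \<subseteq> {J. set J \<subseteq> ?W \<and> length J \<le> ?n}"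
  proof
    fix J assume "J \<in> {J. refines J I}"
    then have ne: "[] \<notin> set J" and eq: "concat J = concat I" by (simp_all add: refines_def)
    have "set J \<subseteq> ?W"
    proof
      fix w assume "w \<in> set J"
      then show "w \<in> ?W" using 2[of w J] 3[of w J] unfolding eq by simp
    qed
    then show "J \<in> {J. set J \<subseteq> ?W \<and> length J \<le> ?n}"
      using 1[OF ne] unfolding eq by simp
  qed
qed

lemma entries_in_indices:
  assumes "T \<in> fillings J" "\<And>i. set (u i) = set (concat (map2 (row_colors i) J T))"
  shows "set (concat T) \<subseteq> indices (type_monomial u (max_entry T))"
proof
  fix e assume e: "e \<in> set (concat T)"
  then have e1: "1 \<le> e" using assms(1) by (auto simp: fillings_def)
  have e2: "e \<le> max_entry T" unfolding max_entry_def using e by (intro Max_ge) auto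
  from e obtain r where "r \<in> set T" "e \<in> set r" by auto
  then obtain n k where n: "n < length T" "k < length (T ! n)" "e = T ! n ! k"
    by (metis in_set_conv_nth)
  have eq: "map length T = map length J" using assms(1) by (simp add: fillings_def)
  have len: "length T = length J" "length (T ! n) = length (J ! n)"
    using eq n(1) by (metis length_map, metis length_map nth_map)
  have "(J ! n, T ! n) \<in> set (zip J T)" using n len by (auto simp: set_zip)
  then have "set (row_colors e (J ! n) (T ! n)) \<subseteq> set (u e)"
    unfolding assms(2) set_concat set_map by (intro UN_upper) (rule image_eqI, simp_all)
  moreover have "(J ! n ! k, e) \<in> set (zip (J ! n) (T ! n))"
    using n len by (auto simp: set_zip)
  then have "J ! n ! k \<in> set (row_colors e (J ! n) (T ! n))"
    unfolding row_colors_def set_map set_filter by (intro image_eqI[of _ _ "(J ! n ! k, e)"]) simp_all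
  ultimately have "J ! n ! k \<in> set (u e)" by (rule subsetD)
  then have "u e \<noteq> []" by auto
  then have "e \<in> indices (xword (u e) e)" by (simp add: indices_xword)
  moreover have "e \<in> set [1..<Suc (max_entry T)]" using e1 e2 by (simp del: upt_Suc)
  ultimately show "e \<in> indices (type_monomial u (max_entry T))"
    unfolding type_monomial_def indices_prod_list set_map by blast
qed

lemma finite_fillings_fibre:
  fixes J :: "'a list list"
  assumes "\<And>T. T \<in> S \<Longrightarrow> T \<in> fillings J"
    and "\<And>T i. set (u T i) = set (concat (map2 (row_colors i) J T))"
  shows "finite {T \<in> S. type_monomial (u T) (max_entry T) = m}"
proof (rule finite_subset)
  let ?R = "{r. set r \<subseteq> indices m \<and> length r \<le> Max (insert 0 (length ` set J))}"
  show "finite {T. set T \<subseteq> ?R \<and> length T = length J}"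
    by (intro finite_lists_length_eq finite_lists_length_le finite_indices)
  show "{T \<in> S. type_monomial (u T) (max_entry T) = m} \<subseteq> {T. set T \<subseteq> ?R \<and> length T = length J}"
  proof
    fix T assume "T \<in> {T \<in> S. type_monomial (u T) (max_entry T) = m}"
    then have TS: "T \<in> S" and m: "type_monomial (u T) (max_entry T) = m" by simp_all
    have TJ: "T \<in> fillings J" using TS by (rule assms(1))
    have T: "set (concat T) \<subseteq> indices m"
      using entries_in_indices[OF TJ assms(2)] unfolding m .
    have eq: "map length T = map length J" using TJ by (simp add: fillings_def)
    have "length T = length J" using eq by (rule map_eq_imp_length_eq)
    moreover have "r \<in> ?R" if r: "r \<in> set T" for r
    proof -
      have "length r \<in> length ` set J" using r arg_cong[OF eq, of set] by auto
      then have "length r \<le> Max (insert 0 (length ` set J))" by (intro Max_ge) auto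
      then show "r \<in> ?R" using T r by auto
    qed
    ultimately show "T \<in> {T. set T \<subseteq> ?R \<and> length T = length J}" by blast
  qed
qed

lemma finite_CIT_fibre:
  "finite {T \<in> CIT J. type_monomial (CIT_type J T) (max_entry T) = m}"
proof (rule finite_fillings_fibre[where J = J and u = "CIT_type J"])
  show "T \<in> fillings J" if "T \<in> CIT J" for T using that by (simp add: CIT_def)
  show "set (CIT_type J T i) = set (concat (map2 (row_colors i) J T))" for T i
    by (simp add: CIT_type_def)
qed

lemma finite_CRSIT_fibre:
  "finite {T \<in> CRSIT J. type_monomial (CRSIT_type J T) (max_entry T) = m}"
proof (rule finite_fillings_fibre[where J = J and u = "CRSIT_type J"])
  show "T \<in> fillings J" if "T \<in> CRSIT J" for T using that by (simp add: CRSIT_def)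
  show "set (CRSIT_type J T i) = set (concat (map2 (row_colors i) J T))" for T i
    by (simp add: CRSIT_type_def)
qed

end

theory Submission
  imports Defs "HOL-Library.Multiset"
begin

text \<open>Both tableau functions are generating functions of P-partitions on the boxes of the diagram,
  for one and the same poset: rows increase from left to right, the first column from top to bottom.
  A labelling order on the boxes decides which of these inequalities are strict, and the order for
  row-strict tableaux is the reverse of the one for immaculate tableaux. By the fundamental lemma of
  P-partitions each function is the sum of \<open>F\<close> over the linear extensions of the poset, indexed by
  the word of colors split at the descents. Reversing the labelling order complements every descent
  set, which is what \<open>\<psi>\<close> does.\<close>

section \<open>Projections of monomials\<close>

text \<open>Variables of equal index do not commute, so the labelling order has two jobs at once: it
  decides which inequalities are strict, and it must list boxes with equal entries in the order in
  which the type reads them. For immaculate tableaux the reading order of the type itself, lowest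
  row first and left to right, does both. Its reverse runs through each row from right to left,
  unlike the type of a row-strict tableau; the two readings agree because a strict row holds each
  value at most once.

  A second obstacle is that \<open>qsym_psi\<close> is a definite description, so a linear map with
  the prescribed values on the F has to be exhibited. It is given by a formula on coefficients, in
  place of a proof that the F are linearly independent; uniqueness only uses that the F
  span.\<close>

lift_definition proj :: "nat \<Rightarrow> 'a pcmon \<Rightarrow> 'a list" is
  "\<lambda>j u. map fst (filter (\<lambda>p. snd p = j) u)"
proof -
  fix j and u v :: "('a \<times> nat) list"
  assume "pc_eq u v"
  then show "map fst (filter (\<lambda>p. snd p = j) u) = map fst (filter (\<lambda>p. snd p = j) v)"
    unfolding pc_eq_def by (induction rule: rtranclp_induct) (auto elim!: pc_step.cases)
qed

lemma proj_one [simp]: "proj j 1 = []"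
  by transfer simp

lemma proj_mult [simp]: "proj j (m * n) = proj j m @ proj j n"
  by transfer simp

lemma proj_var [simp]: "proj j (var a i) = (if i = j then [a] else [])"
  by transfer simp

lemma proj_prod_list: "proj j (prod_list ms) = concat (map (proj j) ms)"
  by (induction ms) auto

lemma xword_Nil [simp]: "xword [] i = 1"
  by (simp add: xword_def)

lemma xword_Cons: "xword (a # w) i = var a i * xword w i"
  by (simp add: xword_def)

lemma proj_xword [simp]: "proj j (xword w i) = (if i = j then w else [])"
  by (induction w) (auto simp: xword_Cons)

lemma indices_iff_proj: "i \<in> indices m \<longleftrightarrow> proj i m \<noteq> []"
  by transfer (force simp: filter_empty_conv)

lemma proj_prod_xword:
  assumes "length I = length js" "distinct js" "k < length js"
  shows "proj (js ! k) (prod_list (map2 xword I js)) = I ! k"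
  using assms
proof (induction I js arbitrary: k rule: list_induct2)
  case (Cons w I j js)
  have *: "proj i (prod_list (map2 xword I js)) = []" if "i \<notin> set js" for i
    using that by (auto simp: proj_prod_list set_zip)
  show ?case
    using Cons * by (cases k) (auto simp: nth_eq_iff_index_eq)
qed simp

text \<open>Inductive step of the normal form in \<open>prod_xword_proj\<close>: a new variable of
  index \<open>i\<close> passes the factors of other indices and is absorbed at the front of the
  factor for \<open>i\<close>.\<close>

lemma prod_xword_update:
  assumes "distinct L" "i \<in> set L"
  shows "(\<Prod>j\<leftarrow>L. xword (if j = i then a # f j else f j) j) = var a i * (\<Prod>j\<leftarrow>L. xword (f j) j)"
  using assms
proof (induction L)
  case (Cons k L)
  have comm: "var a i * xword w k = xword w k * var a i" if "k \<noteq> i" for w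
    by (induction w) (use that in \<open>auto simp: xword_Cons var_commute[of i k] mult.assoc[symmetric]\<close>,
      metis mult.assoc)
  show ?case
  proof (cases "k = i")
    case True
    then have "(\<Prod>j\<leftarrow>L. xword (if j = i then a # f j else f j) j) = (\<Prod>j\<leftarrow>L. xword (f j) j)"
      using Cons.prems by (intro arg_cong[of _ _ prod_list] map_cong) auto
    then show ?thesis using True by (simp add: xword_Cons mult.assoc)
  next
    case False
    then show ?thesis using Cons comm by (simp add: mult.assoc[symmetric])
  qed
qed simp

lemma pcmon_induct [case_names one mult]:
  assumes "P 1" "\<And>a i m. P m \<Longrightarrow> P (var a i * m)"
  shows "P m"
proof (induction m rule: pcmon.abs_induct)
  fix u :: "('a \<times> nat) list"
  show "P (abs_pcmon u)"
  proof (induction u)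
    case Nil
    then show ?case using assms(1) by (simp add: one_pcmon.abs_eq)
  next
    case (Cons p u)
    have "abs_pcmon (p # u) = var (fst p) (snd p) * abs_pcmon u"
      by (simp add: times_pcmon.abs_eq var.abs_eq)
    then show ?case using Cons assms(2) by simp
  qed
qed

text \<open>\<open>L\<close> may list more indices than \<open>m\<close> has, since the extra
  factors are 1. So \<open>L\<close> stays fixed while \<open>m\<close> shrinks in the
  induction.\<close>

lemma prod_xword_proj:
  assumes "distinct L" "indices m \<subseteq> set L"
  shows "(\<Prod>j\<leftarrow>L. xword (proj j m) j) = m"
  using assms(2)
proof (induction m rule: pcmon_induct)
  case one
  show ?case by (induction L) auto
next
  case (mult a i m)
  have "(\<Prod>j\<leftarrow>L. xword (proj j (var a i * m)) j)
      = (\<Prod>j\<leftarrow>L. xword (if j = i then a # proj j m else proj j m) j)"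
    by (intro arg_cong[of _ _ prod_list] map_cong) auto
  also have "\<dots> = var a i * m"
    using mult assms(1) by (subst prod_xword_update) auto
  finally show ?case .
qed

text \<open>A commutation never disturbs the word of colors at a single index, and the normal form
  rebuilds the monomial from these words: they are a complete invariant.\<close>

lemma pcmon_eqI:
  assumes "\<And>j. proj j m = proj j m'"
  shows "m = m'"
proof -
  have "indices m = indices m'"
    using assms by (auto simp: indices_iff_proj)
  then show ?thesis
    using prod_xword_proj[of "sorted_list_of_set (indices m)" m]
      prod_xword_proj[of "sorted_list_of_set (indices m)" m'] assms finite_indices[of m]
    by simp
qed

section \<open>Shape of a monomial; coefficients of M and F\<close>

definition index_list :: "'a pcmon \<Rightarrow> nat list" where
  "index_list m = sorted_list_of_set (indices m)"

text \<open>The only sentence \<open>I\<close> of nonempty words for which \<open>qsym_M I\<close>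
  can contain \<open>m\<close>.\<close>

definition shape :: "'a pcmon \<Rightarrow> 'a list list" where
  "shape m = map (\<lambda>j. proj j m) (index_list m)"

lemma set_index_list [simp]: "set (index_list m) = indices m"
  by (simp add: index_list_def finite_indices)

lemma sorted_index_list: "sorted_wrt (<) (index_list m)"
  by (simp add: index_list_def)

lemma distinct_index_list: "distinct (index_list m)"
  by (simp add: index_list_def)

lemma length_shape: "length (shape m) = length (index_list m)"
  by (simp add: shape_def)

lemma Nil_notin_shape: "[] \<notin> set (shape m)"
  by (auto simp: shape_def indices_iff_proj)

lemma prod_shape:
  fixes m :: "'b pcmon"
  shows "prod_list (map2 xword (shape m) (index_list m)) = m"
proof -
  have "map2 g (map f js) js = map (\<lambda>j. g (f j) j) js"
    for f :: "nat \<Rightarrow> 'b list" and g :: "'b list \<Rightarrow> nat \<Rightarrow> 'b pcmon" and js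
    by (induction js) auto
  then show ?thesis
    using prod_xword_proj[OF distinct_index_list, of m m] by (simp add: shape_def)
qed

lemma indices_prod_xword:
  assumes "[] \<notin> set I" "length I = length js"
  shows "indices (prod_list (map2 xword I js)) = set js"
  using assms(2,1) by (induction I js rule: list_induct2) (auto simp: indices_xword)

lemma index_list_prod_xword:
  assumes "[] \<notin> set I" "length I = length js" "sorted_wrt (<) js"
  shows "index_list (prod_list (map2 xword I js)) = js"
  using assms by (simp add: index_list_def indices_prod_xword
      sorted_list_of_set.idem_if_sorted_distinct strict_sorted_iff)

lemma shape_prod_xword:
  assumes "[] \<notin> set I" "length I = length js" "sorted_wrt (<) js"
  shows "shape (prod_list (map2 xword I js)) = I"
  using assms by (intro nth_equalityI)
    (auto simp: shape_def index_list_prod_xword proj_prod_xword strict_sorted_iff)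

text \<open>The index sequence can be recovered from the monomial, so every fibre has at most one
  element. Index 0 is excluded because the type admits it while \<open>index_seqs\<close> starts at
  1.\<close>

lemma qsym_M_eq:
  fixes I :: "'a list list"
  assumes "[] \<notin> set I"
  shows "(qsym_M I :: ('a, 'k::comm_ring_1) series) m = of_bool (0 \<notin> indices m \<and> shape m = I)"
proof -
  have "{js \<in> index_seqs (length I). prod_list (map2 xword I js) = m}
      = (if 0 \<notin> indices m \<and> shape m = I then {index_list m} else {})"
  proof (intro set_eqI iffI)
    fix js assume "js \<in> {js \<in> index_seqs (length I). prod_list (map2 xword I js) = m}"
    then have js: "js \<in> index_seqs (length I)" and m: "m = prod_list (map2 xword I js)" by auto
    from js have *: "length I = length js" "sorted_wrt (<) js" "0 \<notin> set js"
      by (auto simp: index_seqs_def)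
    then show "js \<in> (if 0 \<notin> indices m \<and> shape m = I then {index_list m} else {})"
      using assms by (simp add: m indices_prod_xword shape_prod_xword index_list_prod_xword)
  next
    fix js assume "js \<in> (if 0 \<notin> indices m \<and> shape m = I then {index_list m} else {})"
    then have *: "0 \<notin> indices m" "shape m = I" "js = index_list m" by (auto split: if_splits)
    moreover have "1 \<le> j" if "j \<in> indices m" for j
      using that *(1) by (cases j) auto
    ultimately show "js \<in> {js \<in> index_seqs (length I). prod_list (map2 xword I js) = m}"
      using prod_shape[of m] sorted_index_list[of m] length_shape[of m]
      by (auto simp: index_seqs_def)
  qed
  then show ?thesis by (simp add: qsym_M_def formal_sum_def)
qed

text \<open>The M have disjoint supports, so only \<open>J = shape m\<close> can contribute to the
  sum over refinements.\<close>

lemma qsym_F_eq: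
  fixes I :: "'a list list"
  shows "(qsym_F I :: ('a, 'k::comm_ring_1) series) m = of_bool (0 \<notin> indices m \<and> refines (shape m) I)"
proof -
  have sum_apply: "(\<Sum>J\<in>S. f J) m = (\<Sum>J\<in>S. f J m)" if "finite S"
    for S and f :: "'a list list \<Rightarrow> ('a, 'k) series"
    using that by (induction S rule: finite_induct) auto
  have "(qsym_F I :: ('a, 'k) series) m = (\<Sum>J | refines J I. qsym_M J m)"
    unfolding qsym_F_def using finite_refinements by (rule sum_apply)
  also have "\<dots> = (\<Sum>J | refines J I. if J = shape m then of_bool (0 \<notin> indices m) else 0)"
    by (intro sum.cong refl, subst qsym_M_eq) (auto simp: refines_def)
  finally show ?thesis by (simp add: finite_refinements)
qed

section \<open>Sentences and their splitting positions\<close>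

text \<open>The cut positions together with both ends, 0 and the total length. With the ends
  included, prepending a word is a plain shift (\<open>prefix_lengths_Cons\<close>).\<close>

definition prefix_lengths :: "'a list list \<Rightarrow> nat set" where
  "prefix_lengths I = (\<lambda>k. length (concat (take k I))) ` {..length I}"

definition cuts :: "'a list list \<Rightarrow> nat set" where
  "cuts I = {i \<in> {0<..<length (concat I)}. splits_after I i}"

lemma prefix_lengths_Nil [simp]: "prefix_lengths [] = {0}"
  by (simp add: prefix_lengths_def)

lemma prefix_lengths_Cons:
  "prefix_lengths (w # I) = insert 0 ((\<lambda>i. length w + i) ` prefix_lengths I)"
proof -
  have "{..length (w # I)} = insert 0 (Suc ` {..length I})"
    by (simp add: atMost_Suc_eq_insert_0)
  then show ?thesis
    unfolding prefix_lengths_def by (simp add: image_image)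
qed

lemma zero_in_prefix_lengths: "0 \<in> prefix_lengths I"
  by (cases I) (auto simp: prefix_lengths_Cons)

lemma length_in_prefix_lengths: "length (concat I) \<in> prefix_lengths I"
  by (induction I) (auto simp: prefix_lengths_Cons)

lemma prefix_lengths_le: "i \<in> prefix_lengths I \<Longrightarrow> i \<le> length (concat I)"
  by (induction I arbitrary: i) (auto simp: prefix_lengths_Cons)

lemma prefix_length_mono:
  assumes "k \<le> l"
  shows "length (concat (take k I)) \<le> length (concat (take l I))"
proof -
  have "take l I = take k I @ take (l - k) (drop k I)"
    using assms take_add[of k "l - k" I] by simp
  then show ?thesis by simp
qed

lemma prefix_length_Suc:
  "k < length I \<Longrightarrow> length (concat (take (Suc k) I)) = length (concat (take k I)) + length (I ! k)"
  by (simp add: take_Suc_conv_app_nth)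

lemma letter_in_word_unique:
  assumes "letter_in_word I i k" "letter_in_word I i l"
  shows "k = l"
proof -
  have "\<not> a < b" if "letter_in_word I i a" "letter_in_word I i b" for a b
    using that prefix_length_mono[of "Suc a" b I] by (auto simp: letter_in_word_def)
  then show ?thesis using assms by (metis nat_neq_iff)
qed

lemma letter_in_word_mono:
  assumes "letter_in_word I i k" "letter_in_word I j l" "i \<le> j"
  shows "k \<le> l"
proof (rule ccontr)
  assume "\<not> k \<le> l"
  then show False
    using assms prefix_length_mono[of "Suc l" k I] by (auto simp: letter_in_word_def)
qed

lemma letter_in_word_exists:
  assumes "0 < i" "i \<le> length (concat I)"
  obtains k where "letter_in_word I i k"
proof -
  define k where "k = (LEAST k. i \<le> length (concat (take k I)))"
  have k: "i \<le> length (concat (take k I))"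
    unfolding k_def by (rule LeastI[of _ "length I"]) (use assms in simp)
  have le: "k \<le> length I"
    unfolding k_def by (rule Least_le) (use assms in simp)
  have "k \<noteq> 0" using k assms(1) by (cases k) auto
  then obtain l where l: "k = Suc l" by (cases k) auto
  have "\<not> i \<le> length (concat (take l I))"
    using not_less_Least[of l "\<lambda>k. i \<le> length (concat (take k I))"] l k_def by simp
  then show ?thesis using that[of l] k l le by (simp add: letter_in_word_def)
qed

lemma splits_after_iff:
  assumes "[] \<notin> set I" "0 < i" "i < length (concat I)"
  shows "splits_after I i \<longleftrightarrow> i \<in> prefix_lengths I"
proof
  assume "splits_after I i"
  then obtain k l where k: "letter_in_word I i k" and l: "letter_in_word I (Suc i) l" and "k \<noteq> l"
    by (auto simp: splits_after_def)
  then have "Suc k \<le> l"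
    using letter_in_word_mono[OF k l] by simp
  \<comment> \<open>Squeezed: \<open>i\<close> is at most the end of word \<open>k\<close>, which is
    at most the start of word \<open>l\<close>, which is at most \<open>i\<close>.\<close>
  then have "i = length (concat (take (Suc k) I))"
    using k l prefix_length_mono[of "Suc k" l I] by (auto simp: letter_in_word_def)
  then show "i \<in> prefix_lengths I"
    using k by (auto simp: prefix_lengths_def letter_in_word_def)
next
  assume "i \<in> prefix_lengths I"
  then obtain k where k: "k \<le> length I" "i = length (concat (take k I))"
    by (auto simp: prefix_lengths_def)
  have "k \<noteq> 0" using k assms(2) by (cases k) auto
  then obtain l where l: "k = Suc l" by (cases k) auto
  have "k \<noteq> length I" using k assms(3) by auto
  then have "k < length I" using k by simp
  \<comment> \<open>Both words being nonempty, letter \<open>i\<close> is the last of word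
    \<open>l\<close> and letter \<open>Suc i\<close> the first of word \<open>k\<close>.\<close>
  moreover have "I ! k \<noteq> []" "I ! l \<noteq> []"
    using assms(1) l calculation by (metis nth_mem Suc_lessD)+
  ultimately have "letter_in_word I i l" "letter_in_word I (Suc i) k"
    using k l prefix_length_Suc[of k I] prefix_length_Suc[of l I]
    by (auto simp: letter_in_word_def Suc_le_eq)
  then show "splits_after I i"
    using l n_not_Suc_n unfolding splits_after_def by blast
qed

lemma cuts_eq:
  "[] \<notin> set I \<Longrightarrow> cuts I = prefix_lengths I \<inter> {0<..<length (concat I)}"
  by (auto simp: cuts_def splits_after_iff)

lemma prefix_lengths_eq:
  "[] \<notin> set I \<Longrightarrow> prefix_lengths I = {0, length (concat I)} \<union> cuts I"
  using zero_in_prefix_lengths[of I] length_in_prefix_lengths[of I] prefix_lengths_le[of _ I]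
  by (force simp: cuts_eq)

section \<open>Sentences as words with a set of cuts\<close>

lemma prefix_lengths_append_subset: "prefix_lengths (I @ J) \<supseteq> (\<lambda>i. length (concat I) + i) ` prefix_lengths J"
  by (induction I) (auto simp: prefix_lengths_Cons image_iff add.assoc)

lemma refines_imp_prefix_lengths:
  assumes "refines J I"
  shows "prefix_lengths I \<subseteq> prefix_lengths J"
proof -
  have "prefix_lengths (map concat G) \<subseteq> prefix_lengths (concat G)" for G :: "'a list list list"
  proof (induction G)
    case (Cons g G)
    then have "prefix_lengths (map concat (g # G))
        \<subseteq> insert 0 ((\<lambda>i. length (concat g) + i) ` prefix_lengths (concat G))"
      by (auto simp: prefix_lengths_Cons)
    also have "\<dots> \<subseteq> prefix_lengths (concat (g # G))"
      using prefix_lengths_append_subset[of g "concat G"] zero_in_prefix_lengths by auto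
    finally show ?case .
  qed simp
  then show ?thesis using assms by (auto simp: refines_def)
qed

text \<open>The end of the first word of \<open>I\<close> is also the end of some word of
  \<open>J\<close>, so an initial segment of \<open>J\<close> concatenates to that word and forms
  the first group; the rest follows by induction.\<close>

lemma prefix_lengths_imp_refines:
  assumes "[] \<notin> set J" "concat J = concat I" "prefix_lengths I \<subseteq> prefix_lengths J"
  shows "\<exists>G. concat G = J \<and> map concat G = I"
  using assms
proof (induction I arbitrary: J)
  case Nil
  then have "J = []" by (cases J) auto
  then show ?case by (intro exI[of _ "[]"]) simp
next
  case (Cons w I)
  have "length w \<in> prefix_lengths (w # I)"
    using zero_in_prefix_lengths by (force simp: prefix_lengths_Cons)
  then obtain k where k: "k \<le> length J" "length w = length (concat (take k J))"
    using Cons.prems(3) by (auto simp: prefix_lengths_def)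
  have "concat (take k J) @ concat (drop k J) = w @ concat I"
    using Cons.prems(2) by (metis append_take_drop_id concat.simps(2) concat_append)
  then have w: "concat (take k J) = w" and I: "concat (drop k J) = concat I"
    using k by auto
  have "prefix_lengths I \<subseteq> prefix_lengths (drop k J)"
  proof
    fix i assume "i \<in> prefix_lengths I"
    then have "length w + i \<in> prefix_lengths J"
      using Cons.prems(3) by (auto simp: prefix_lengths_Cons)
    then obtain l where l: "l \<le> length J" "length w + i = length (concat (take l J))"
      by (auto simp: prefix_lengths_def)
    show "i \<in> prefix_lengths (drop k J)"
    proof (cases "k \<le> l")
      case True
      then have "take l J = take k J @ take (l - k) (drop k J)"
        using take_add[of k "l - k" J] by simp
      then have "i = length (concat (take (l - k) (drop k J)))"
        using l k by simp
      then show ?thesis using l by (auto simp: prefix_lengths_def intro!: imageI)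
    next
      case False
      then have "i = 0" using l k prefix_length_mono[of l k J] by simp
      then show ?thesis by (simp add: zero_in_prefix_lengths)
    qed
  qed
  then obtain G where "concat G = drop k J" "map concat G = I"
    using Cons.IH[of "drop k J"] I Cons.prems(1) in_set_dropD by metis
  then show ?case using w by (intro exI[of _ "take k J # G"]) simp
qed

text \<open>Sentences over a fixed word thereby become subsets of its interior positions, ordered by
  reverse inclusion, and complements of sentences become set complements.\<close>

lemma refines_iff_cuts:
  assumes "[] \<notin> set J" "[] \<notin> set I"
  shows "refines J I \<longleftrightarrow> concat J = concat I \<and> cuts I \<subseteq> cuts J"
proof
  assume "refines J I"
  then show "concat J = concat I \<and> cuts I \<subseteq> cuts J"
    using refines_imp_prefix_lengths[of J I] assms by (auto simp: refines_def cuts_eq)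
next
  assume *: "concat J = concat I \<and> cuts I \<subseteq> cuts J"
  then have "prefix_lengths I \<subseteq> prefix_lengths J"
    using assms by (auto simp: prefix_lengths_eq)
  then show "refines J I"
    using prefix_lengths_imp_refines[of J I] assms * by (simp add: refines_def)
qed

text \<open>The length of the first word is the least positive prefix length, which determines that
  word; strip it and repeat.\<close>

lemma sentence_eqI_prefix_lengths:
  assumes "[] \<notin> set I" "[] \<notin> set J" "concat I = concat J" "prefix_lengths I = prefix_lengths J"
  shows "I = J"
  using assms
proof (induction I arbitrary: J)
  case Nil
  then show ?case by (cases J) auto
next
  case (Cons v I)
  then obtain w K where J: "J = w # K" by (cases J) auto
  have ne: "v \<noteq> []" "w \<noteq> []" using Cons.prems J by auto
  have le: "length b \<le> length a"
    if "prefix_lengths (a # L) = prefix_lengths (b # M)" "a \<noteq> []" for a b :: "'a list" and L M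
  proof -
    have "length a \<in> prefix_lengths (a # L)"
      using zero_in_prefix_lengths by (force simp: prefix_lengths_Cons)
    then show ?thesis using that by (auto simp: prefix_lengths_Cons)
  qed
  have len: "length v = length w"
    using le[of v I w K] le[of w K v I] Cons.prems(4) J ne by auto
  then have vw: "v = w" and "concat I = concat K"
    using Cons.prems(3) J by auto
  moreover have "prefix_lengths I = prefix_lengths K"
  proof -
    have "(\<lambda>i. length v + i) ` prefix_lengths I = prefix_lengths (v # I) - {0}"
      using ne by (auto simp: prefix_lengths_Cons)
    also have "\<dots> = (\<lambda>i. length v + i) ` prefix_lengths K"
      using ne Cons.prems(4) J vw by (auto simp: prefix_lengths_Cons)
    finally show ?thesis by (simp add: inj_image_eq_iff inj_def)
  qed
  ultimately show ?case using Cons.IH[of K] Cons.prems J by auto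
qed

lemma sentence_eqI:
  assumes "[] \<notin> set I" "[] \<notin> set J" "concat I = concat J" "cuts I = cuts J"
  shows "I = J"
  using assms by (intro sentence_eqI_prefix_lengths) (auto simp: prefix_lengths_eq)

text \<open>Induction on the word: the first letter forms a word of its own if 1 is in
  \<open>S\<close>, and otherwise joins the first word of the sentence built for the remaining
  letters.\<close>

lemma sentence_exists:
  "\<exists>I. [] \<notin> set I \<and> concat I = w \<and> cuts I = S \<inter> {0<..<length w}"
proof -
  have "\<exists>I. [] \<notin> set I \<and> concat I = w \<and> prefix_lengths I = {0, length w} \<union> (S \<inter> {0<..<length w})"
  proof (induction w arbitrary: S)
    case Nil
    show ?case by (intro exI[of _ "[]"]) auto
  next
    case (Cons c w)
    show ?case
    proof (cases w)
      case Nil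
      then show ?thesis by (intro exI[of _ "[[c]]"]) (auto simp: prefix_lengths_Cons)
    next
      case (Cons d v)
      \<comment> \<open>Removing the first letter lowers every position by one.\<close>
      from Cons.IH[of "{i. Suc i \<in> S}"] obtain I where
        I: "[] \<notin> set I" "concat I = w"
           "prefix_lengths I = {0, length w} \<union> ({i. Suc i \<in> S} \<inter> {0<..<length w})"
        by blast
      have shift: "Suc ` ({i. Suc i \<in> S} \<inter> {0<..<length w}) = S \<inter> {1<..<Suc (length w)}"
      proof (intro set_eqI iffI)
        fix i assume "i \<in> S \<inter> {1<..<Suc (length w)}"
        then show "i \<in> Suc ` ({i. Suc i \<in> S} \<inter> {0<..<length w})"
          by (cases i) auto
      qed auto
      from I Cons obtain u K where K: "I = u # K" "u \<noteq> []" by (cases I) auto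
      show ?thesis
      proof (cases "1 \<in> S")
        case True
        have "prefix_lengths ([c] # I) = {0, 1, Suc (length w)} \<union> (S \<inter> {1<..<Suc (length w)})"
          by (simp add: prefix_lengths_Cons I(3) image_Un shift)
        also have "\<dots> = {0, length (c # w)} \<union> (S \<inter> {0<..<length (c # w)})"
          using True Cons by (auto simp: not_less)
        finally have "prefix_lengths ([c] # I) = {0, length (c # w)} \<union> (S \<inter> {0<..<length (c # w)})" .
        then show ?thesis using I by (intro exI[of _ "[c] # I"]) auto
      next
        case False
        have "prefix_lengths ((c # u) # K) = insert 0 (Suc ` (prefix_lengths I - {0}))"
          using K by (auto simp: prefix_lengths_Cons)
        also have "prefix_lengths I - {0} = {length w} \<union> ({i. Suc i \<in> S} \<inter> {0<..<length w})"
          using Cons by (auto simp: I(3))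
        also have "insert 0 (Suc ` \<dots>) = {0, Suc (length w)} \<union> (S \<inter> {1<..<Suc (length w)})"
          by (simp add: image_Un shift)
        also have "\<dots> = {0, length (c # w)} \<union> (S \<inter> {0<..<length (c # w)})"
          using False by (auto simp: nat_neq_iff) (metis One_nat_def Suc_lessI)
        finally show ?thesis using I K by (intro exI[of _ "(c # u) # K"]) auto
      qed
    qed
  qed
  then obtain I where "[] \<notin> set I" "concat I = w"
      "prefix_lengths I = {0, length w} \<union> (S \<inter> {0<..<length w})"
    by blast
  then show ?thesis by (intro exI[of _ I]) (auto simp: cuts_eq)
qed

text \<open>\<open>S\<close> may be any set of naturals, since only interior positions count;
  complements can thus be taken in all of \<open>nat\<close>.\<close>

definition cut_at :: "'a list \<Rightarrow> nat set \<Rightarrow> 'a list list" where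
  "cut_at w S = (THE I. [] \<notin> set I \<and> concat I = w \<and> cuts I = S \<inter> {0<..<length w})"

lemma cut_at:
  shows Nil_notin_cut_at: "[] \<notin> set (cut_at w S)"
    and concat_cut_at [simp]: "concat (cut_at w S) = w"
    and cuts_cut_at [simp]: "cuts (cut_at w S) = S \<inter> {0<..<length w}"
proof -
  have "\<exists>!I. [] \<notin> set I \<and> concat I = w \<and> cuts I = S \<inter> {0<..<length w}"
    using sentence_exists[of w S] by (intro ex_ex1I) (auto intro: sentence_eqI)
  from theI'[OF this, folded cut_at_def]
  show "[] \<notin> set (cut_at w S)" "concat (cut_at w S) = w" "cuts (cut_at w S) = S \<inter> {0<..<length w}"
    by auto
qed

lemma complement_eq:
  assumes "[] \<notin> set I"
  shows "complement I = cut_at (concat I) (- cuts I)"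
  unfolding complement_def
proof (rule the_equality)
  have "splits_after K i \<longleftrightarrow> i \<in> cuts K" if "1 \<le> i" "i < length (concat K)" for K :: "'a list list" and i
    using that by (auto simp: cuts_def)
  note * = this
  show "[] \<notin> set (cut_at (concat I) (- cuts I)) \<and>
    concat (cut_at (concat I) (- cuts I)) = concat I \<and>
    (\<forall>i. 1 \<le> i \<and> i < length (concat I) \<longrightarrow>
      splits_after (cut_at (concat I) (- cuts I)) i = (\<not> splits_after I i))"
    using *[of _ I] *[of _ "cut_at (concat I) (- cuts I)"] by (simp add: Nil_notin_cut_at)
  fix K assume K: "[] \<notin> set K \<and> concat K = concat I \<and>
    (\<forall>i. 1 \<le> i \<and> i < length (concat I) \<longrightarrow> splits_after K i = (\<not> splits_after I i))"
  then have "cuts K = - cuts I \<inter> {0<..<length (concat I)}"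
    by (auto simp: cuts_def)
  then show "K = cut_at (concat I) (- cuts I)"
    using K by (intro sentence_eqI) (auto simp: Nil_notin_cut_at)
qed

lemma sentences_iff: "I \<in> sentences A \<longleftrightarrow> [] \<notin> set I \<and> set (concat I) \<subseteq> A"
  by (auto simp: sentences_def in_lists_conv_set)

section \<open>The involution\<close>

text \<open>A test monomial: for nonempty words and a series in QSym, the value here is the
  coefficient of M at \<open>K\<close>.\<close>

definition standard_monomial :: "'a list list \<Rightarrow> 'a pcmon" where
  "standard_monomial K = prod_list (map2 xword K [1..<Suc (length K)])"

lemma
  assumes "[] \<notin> set K"
  shows shape_standard_monomial [simp]: "shape (standard_monomial K) = K"
    and zero_notin_standard_monomial [simp]: "0 \<notin> indices (standard_monomial K)"
  using assms unfolding standard_monomial_def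
  by (subst shape_prod_xword indices_prod_xword; simp del: upt_Suc)+

text \<open>Expand the product over \<open>x\<close> in \<open>U\<close> of 1 -
  [\<open>x\<close> not in \<open>S\<close>], which is 1 if \<open>U\<close> lies in
  \<open>S\<close> and 0 otherwise.\<close>

lemma sum_neg_one_power_card:
  assumes "finite U"
  shows "(\<Sum>X\<in>Pow U. (-1) ^ card X * of_bool (X \<inter> S = {})) = (of_bool (U \<subseteq> S) :: 'k::comm_ring_1)"
proof -
  have "(\<Prod>x\<in>U. of_bool (x \<in> S)) = (of_bool (U \<subseteq> S) :: 'k)"
    using assms by (induction U rule: finite_induct) (simp_all flip: of_bool_conj)
  then have "of_bool (U \<subseteq> S) = (\<Prod>x\<in>U. of_bool (x \<in> S) :: 'k)" ..
  also have "\<dots> = (\<Prod>x\<in>U. 1 - of_bool (x \<notin> S))"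
    by (intro prod.cong) auto
  also have "\<dots> = (\<Sum>X\<in>Pow U. (-1) ^ card X * (\<Prod>x\<in>X. of_bool (x \<notin> S)))"
    using prod_diff_conv_sum[OF assms, of "\<lambda>x. 1" "\<lambda>x. of_bool (x \<notin> S) :: 'k"] by simp
  also have "\<dots> = (\<Sum>X\<in>Pow U. (-1) ^ card X * of_bool (X \<inter> S = {}))"
  proof (intro sum.cong refl)
    fix X assume "X \<in> Pow U"
    then have "finite X" using assms finite_subset by auto
    then have "(\<Prod>x\<in>X. of_bool (x \<notin> S)) = (of_bool (X \<inter> S = {}) :: 'k)"
      by (induction X rule: finite_induct) (simp_all flip: of_bool_conj)
    then show "(-1) ^ card X * (\<Prod>x\<in>X. of_bool (x \<notin> S)) = (-1) ^ card X * (of_bool (X \<inter> S = {}) :: 'k)"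
      by simp
  qed
  finally show ?thesis by simp
qed

text \<open>The coefficient of \<open>F\<^sub>I\<close> at a monomial whose shape has word \<open>w\<close> and splitting set \<open>T\<close> is
  the truth value of \<open>cuts I \<subseteq> T\<close>. Complementing \<open>cuts I\<close> turns it into that of \<open>- T \<subseteq> cuts I\<close>,
  which inclusion-exclusion expresses linearly through the original coefficients.\<close>

definition psi_coeff :: "('a, 'k::comm_ring_1) series \<Rightarrow> ('a, 'k) series" where
  "psi_coeff f m = (if 0 \<in> indices m then 0 else
     (let w = concat (shape m) in
      \<Sum>X\<in>Pow ({0<..<length w} - cuts (shape m)).
        (-1) ^ card X * f (standard_monomial (cut_at w (- X)))))"

lemma psi_coeff_add: "psi_coeff (f + g) = psi_coeff f + psi_coeff g"
  by (auto simp: psi_coeff_def fun_eq_iff Let_def ring_distribs sum.distrib)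

lemma psi_coeff_scale: "psi_coeff (sscale c f) = sscale c (psi_coeff f)"
  by (auto simp: psi_coeff_def sscale_def fun_eq_iff Let_def sum_distrib_left mult.left_commute)

lemma psi_coeff_F:
  assumes "[] \<notin> set I"
  shows "psi_coeff (qsym_F I) = (qsym_F (complement I) :: ('a, 'k::comm_ring_1) series)"
proof
  fix m :: "'a pcmon"
  let ?w = "concat (shape m)" let ?T = "cuts (shape m)"
  let ?U = "{0<..<length ?w} - ?T"
  have *: "(-1) ^ card X * qsym_F I (standard_monomial (cut_at ?w (- X)))
      = (if ?w = concat I then (-1) ^ card X * of_bool (X \<inter> cuts I = {}) else (0 :: 'k))"
    if "X \<in> Pow ?U" for X
  proof -
    \<comment> \<open>The tested shape is cut everywhere except at \<open>X\<close>, so it refines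
      \<open>I\<close> exactly when \<open>I\<close> has the same word and no cut in
      \<open>X\<close>.\<close>
    have "refines (cut_at ?w (- X)) I \<longleftrightarrow> ?w = concat I \<and> X \<inter> cuts I = {}"
      using assms by (auto simp: refines_iff_cuts Nil_notin_cut_at) (auto simp: cuts_def)
    then show ?thesis by (auto simp: qsym_F_eq Nil_notin_cut_at)
  qed
  have "cuts (complement I) \<subseteq> ?T \<longleftrightarrow> ?U \<subseteq> cuts I" if "?w = concat I"
    using assms that by (auto simp: complement_eq)
  then have "refines (shape m) (complement I) \<longleftrightarrow> ?w = concat I \<and> ?U \<subseteq> cuts I"
    using assms
    by (subst refines_iff_cuts) (auto simp: complement_eq Nil_notin_cut_at Nil_notin_shape)
  moreover have "(\<Sum>X\<in>Pow ?U. (-1) ^ card X * qsym_F I (standard_monomial (cut_at ?w (- X))))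
      = (if ?w = concat I then of_bool (?U \<subseteq> cuts I) else (0 :: 'k))"
  proof (cases "?w = concat I")
    case True
    then have "(\<Sum>X\<in>Pow ?U. (-1) ^ card X * qsym_F I (standard_monomial (cut_at ?w (- X))))
        = (\<Sum>X\<in>Pow ?U. (-1) ^ card X * of_bool (X \<inter> cuts I = {}) :: 'k)"
      by (intro sum.cong refl) (subst *, auto)
    also have "\<dots> = of_bool (?U \<subseteq> cuts I)"
      by (rule sum_neg_one_power_card) simp
    finally show ?thesis using True by simp
  next
    case False
    then show ?thesis by (simp add: *)
  qed
  ultimately show "psi_coeff (qsym_F I) m = (qsym_F (complement I) m :: 'k)"
    unfolding psi_coeff_def Let_def by (subst qsym_F_eq) simp
qed

section \<open>Span of the F; existence and uniqueness of psi\<close>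

lemma refines_sentence:
  assumes "refines J I" "I \<in> sentences A"
  shows "J \<in> sentences A"
  using assms by (metis refines_def sentences_iff)

lemma qsym_F_in_span_M:
  assumes "I \<in> sentences A"
  shows "(qsym_F I :: ('a, 'k::comm_ring_1) series) \<in> QSym A"
  unfolding qsym_F_def QSym_def
  using assms refines_sentence by (intro series.span_sum series.span_base imageI) blast

text \<open>F is M plus the M of strictly finer sentences. Solve for M by induction on the number of
  uncut positions, which drops under strict refinement.\<close>

lemma qsym_M_in_span_F:
  assumes "I \<in> sentences A"
  shows "(qsym_M I :: ('a, 'k::comm_ring_1) series) \<in> series.span (qsym_F ` sentences A)"
  using assms
proof (induction "card ({0<..<length (concat I)} - cuts I)" arbitrary: I rule: less_induct)
  case less
  let ?R = "{J. refines J I}"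
  have ne: "[] \<notin> set I" using less.prems by (simp add: sentences_iff)
  have I: "I \<in> ?R" using ne by (simp add: refines_iff_cuts)
  have "qsym_F I = qsym_M I + (\<Sum>J\<in>?R - {I}. qsym_M J :: ('a, 'k) series)"
    unfolding qsym_F_def using finite_refinements I by (rule sum.remove)
  then have "qsym_M I = qsym_F I - (\<Sum>J\<in>?R - {I}. qsym_M J :: ('a, 'k) series)"
    by simp
  also have "\<dots> \<in> series.span (qsym_F ` sentences A)"
  proof (intro series.span_diff series.span_sum less.hyps)
    show "qsym_F I \<in> (series.span (qsym_F ` sentences A) :: ('a, 'k) series set)"
      using less.prems by (intro series.span_base imageI)
    fix J assume J: "J \<in> ?R - {I}"
    then have "[] \<notin> set J" by (auto simp: refines_def)
    then have "concat J = concat I" "cuts I \<subset> cuts J"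
      using J ne sentence_eqI[of J I] by (auto simp: refines_iff_cuts)
    moreover have "cuts J \<subseteq> {0<..<length (concat J)}"
      by (auto simp: cuts_def)
    ultimately show "card ({0<..<length (concat J)} - cuts J) < card ({0<..<length (concat I)} - cuts I)"
      by (intro psubset_card_mono) auto
    show "J \<in> sentences A" using J less.prems refines_sentence by blast
  qed
  finally show ?case .
qed

lemma QSym_eq_span_F: "QSym A = (series.span (qsym_F ` sentences A) :: ('a, 'k::comm_ring_1) series set)"
proof
  show "QSym A \<subseteq> (series.span (qsym_F ` sentences A) :: ('a, 'k) series set)"
    unfolding QSym_def using qsym_M_in_span_F
    by (intro series.span_minimal series.subspace_span) blast
  show "(series.span (qsym_F ` sentences A) :: ('a, 'k) series set) \<subseteq> QSym A"
    using qsym_F_in_span_M unfolding QSym_def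
    by (intro series.span_minimal series.subspace_span) blast
qed

lemma complement_sentence: "I \<in> sentences A \<Longrightarrow> complement I \<in> sentences A"
  by (auto simp: sentences_iff complement_eq Nil_notin_cut_at)

lemma QSym_induct [consumes 1, case_names zero step]:
  fixes f :: "('a, 'k::comm_ring_1) series"
  assumes "f \<in> QSym A" "P 0"
    and "\<And>c I g. I \<in> sentences A \<Longrightarrow> g \<in> QSym A \<Longrightarrow> P g \<Longrightarrow> P (sscale c (qsym_F I) + g)"
  shows "P f"
proof -
  have "f \<in> series.span (qsym_F ` sentences A)" using assms(1) by (simp add: QSym_eq_span_F)
  \<comment> \<open>Membership is carried along because a candidate for psi is only known to be
    additive on QSym.\<close>
  then have "f \<in> QSym A \<and> P f"
  proof (induction rule: series.span_induct_alt)
    case base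
    have "0 \<in> QSym A \<and> P 0" using assms(2) by (simp add: QSym_def series.span_zero)
    then show ?case .
  next
    case (step c x y)
    have "sscale c x + y \<in> QSym A"
      unfolding QSym_eq_span_F
    proof (intro series.span_add series.span_scale)
      show "x \<in> series.span (qsym_F ` sentences A)" using step by (intro series.span_base)
      show "y \<in> series.span (qsym_F ` sentences A)" using step by (simp add: QSym_eq_span_F)
    qed
    then show ?case using step assms(3) by blast
  qed
  then show ?thesis ..
qed

text \<open>\<open>psi_coeff\<close> has the required properties on QSym; conversely linearity and
  the values on the spanning F fix any candidate there, and \<open>undefined\<close> fixes it
  elsewhere.\<close>

lemma qsym_psi_eq:
  "qsym_psi A = (\<lambda>f :: ('a, 'k::comm_ring_1) series. if f \<in> QSym A then psi_coeff f else undefined)"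
  (is "_ = ?psi")
  unfolding qsym_psi_def
proof (rule the_equality)
  have add: "f + g \<in> QSym A" if "f \<in> QSym A" "g \<in> QSym A" for f g :: "('a, 'k) series"
    using that unfolding QSym_def by (rule series.span_add)
  have scale: "sscale c f \<in> QSym A" if "f \<in> QSym A" for c and f :: "('a, 'k) series"
    using that unfolding QSym_def by (rule series.span_scale)
  have F: "qsym_F I \<in> (QSym A :: ('a, 'k) series set)" if "I \<in> sentences A" for I
    using that by (rule qsym_F_in_span_M)
  have psi_zero: "psi_coeff 0 = (0 :: ('a, 'k) series)"
    by (auto simp: psi_coeff_def fun_eq_iff Let_def)
  have zero_in: "0 \<in> (QSym A :: ('a, 'k) series set)"
    by (simp add: QSym_def series.span_zero)
  have closed: "psi_coeff f \<in> QSym A" if "f \<in> QSym A" for f :: "('a, 'k) series"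
    using that
  proof (induction rule: QSym_induct)
    case zero
    show "psi_coeff 0 \<in> (QSym A :: ('a, 'k) series set)" using zero_in psi_zero by simp
  next
    case (step c I g)
    then show "psi_coeff (sscale c (qsym_F I) + g) \<in> (QSym A :: ('a, 'k) series set)"
      by (auto simp: psi_coeff_add psi_coeff_scale psi_coeff_F sentences_iff
          intro!: add scale F complement_sentence)
  qed
  show "(\<forall>f\<in>QSym A. ?psi f \<in> QSym A) \<and> (\<forall>f. f \<notin> QSym A \<longrightarrow> ?psi f = undefined) \<and>
     (\<forall>f\<in>QSym A. \<forall>g\<in>QSym A. ?psi (f + g) = ?psi f + ?psi g) \<and>
     (\<forall>c. \<forall>f\<in>QSym A. ?psi (sscale c f) = sscale c (?psi f)) \<and>
     (\<forall>I\<in>sentences A. ?psi (qsym_F I) = qsym_F (complement I))"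
    using closed add scale F
    by (auto simp: psi_coeff_add psi_coeff_scale psi_coeff_F sentences_iff)
  fix \<psi> :: "('a, 'k) series \<Rightarrow> ('a, 'k) series"
  assume *: "(\<forall>f\<in>QSym A. \<psi> f \<in> QSym A) \<and> (\<forall>f. f \<notin> QSym A \<longrightarrow> \<psi> f = undefined) \<and>
     (\<forall>f\<in>QSym A. \<forall>g\<in>QSym A. \<psi> (f + g) = \<psi> f + \<psi> g) \<and>
     (\<forall>c. \<forall>f\<in>QSym A. \<psi> (sscale c f) = sscale c (\<psi> f)) \<and>
     (\<forall>I\<in>sentences A. \<psi> (qsym_F I) = qsym_F (complement I))"
  have "\<psi> f = psi_coeff f" if "f \<in> QSym A" for f
    using that
  proof (induction rule: QSym_induct)
    case zero
    \<comment> \<open>Additivity forces the value at 0 to be 0.\<close>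
    have "\<psi> (0 + 0) = \<psi> 0 + \<psi> 0" using * zero_in by blast
    then show "\<psi> 0 = psi_coeff 0" using psi_zero by simp
  next
    case (step c I g)
    then have "\<psi> (sscale c (qsym_F I) + g) = sscale c (\<psi> (qsym_F I)) + \<psi> g"
      using * scale F by metis
    also have "\<dots> = psi_coeff (sscale c (qsym_F I) + g)"
      using * step by (simp add: psi_coeff_add psi_coeff_scale psi_coeff_F sentences_iff)
    finally show ?case .
  qed
  then show "\<psi> = ?psi" using * by auto
qed

lemma qsym_psi_sum_F:
  assumes "finite S" "\<And>s. s \<in> S \<Longrightarrow> I s \<in> sentences A"
  shows "qsym_psi A (\<Sum>s\<in>S. qsym_F (I s)) = (\<Sum>s\<in>S. qsym_F (complement (I s)) :: ('a, 'k::comm_ring_1) series)"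
proof -
  have "psi_coeff (\<Sum>s\<in>S. qsym_F (I s)) = (\<Sum>s\<in>S. qsym_F (complement (I s)) :: ('a, 'k) series)"
    using assms
  proof (induction S rule: finite_induct)
    case empty
    show "psi_coeff (\<Sum>s\<in>{}. qsym_F (I s)) = (\<Sum>s\<in>{}. qsym_F (complement (I s)) :: ('a, 'k) series)"
      by (auto simp: psi_coeff_def fun_eq_iff Let_def)
  next
    case (insert s S)
    then show "psi_coeff (\<Sum>s\<in>insert s S. qsym_F (I s))
        = (\<Sum>s\<in>insert s S. qsym_F (complement (I s)) :: ('a, 'k) series)"
      by (simp add: psi_coeff_add psi_coeff_F sentences_iff)
  qed
  moreover have "(\<Sum>s\<in>S. qsym_F (I s) :: ('a, 'k) series) \<in> QSym A"
    using assms(2) qsym_F_in_span_M[of _ A] unfolding QSym_def by (intro series.span_sum) blast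
  ultimately show ?thesis by (simp add: qsym_psi_eq)
qed

section \<open>Colored P-partitions\<close>

definition expand :: "'a list list \<Rightarrow> nat list \<Rightarrow> ('a \<times> nat) list" where
  "expand I js = concat (map2 (\<lambda>w j. map (\<lambda>c. (c, j)) w) I js)"

text \<open>The representative of \<open>m\<close> with weakly increasing indices. Its colors spell
  the word of the shape, and its strict increases are the cuts (\<open>cuts_shape\<close>).\<close>

definition biword :: "'a pcmon \<Rightarrow> ('a \<times> nat) list" where
  "biword m = expand (shape m) (index_list m)"

lemma expand_Nil [simp]: "expand [] js = []"
  by (simp add: expand_def)

lemma expand_Cons [simp]: "expand (w # I) (j # js) = map (\<lambda>c. (c, j)) w @ expand I js"
  by (simp add: expand_def)

lemma map_fst_expand: "length I = length js \<Longrightarrow> map fst (expand I js) = concat I"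
  by (induction I js rule: list_induct2) (auto simp: comp_def)

lemma snd_expand: "p \<in> set (expand I js) \<Longrightarrow> snd p \<in> set js"
  by (auto simp: expand_def dest: set_zip_rightD)

lemma sorted_expand:
  assumes "length I = length js" "sorted_wrt (<) js"
  shows "sorted (map snd (expand I js))"
  using assms
  by (induction I js rule: list_induct2)
    (auto simp: sorted_append comp_def map_replicate_const dest!: snd_expand intro: less_imp_le)

lemma length_expand: "length I = length js \<Longrightarrow> length (expand I js) = length (concat I)"
  using map_fst_expand[of I js] by (metis length_map)

lemma snd_nth_expand:
  assumes "length I = length js" "letter_in_word I i k"
  shows "snd (expand I js ! (i - 1)) = js ! k"
  using assms
proof (induction I js arbitrary: i k rule: list_induct2)
  case (Cons w I j js)
  show ?case
  proof (cases k)
    case 0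
    then show ?thesis using Cons.prems by (auto simp: letter_in_word_def nth_append)
  next
    case (Suc l)
    then have "letter_in_word I (i - length w) l" and gt: "length w < i"
      using Cons.prems by (auto simp: letter_in_word_def)
    moreover have "i - 1 - length w = i - length w - 1" by simp
    ultimately show ?thesis
      using Cons.IH[of "i - length w" l] Suc by (auto simp: nth_append)
  qed
qed (simp add: letter_in_word_def)

text \<open>Letters are counted from 1 and list entries from 0, so a split after letter
  \<open>i\<close> compares the entries \<open>i - 1\<close> and \<open>i\<close>.\<close>

lemma splits_after_expand:
  assumes "length I = length js" "sorted_wrt (<) js" "0 < i" "i < length (concat I)"
  shows "splits_after I i \<longleftrightarrow> snd (expand I js ! (i - 1)) < snd (expand I js ! i)"
proof -
  obtain k where k: "letter_in_word I i k"
    using letter_in_word_exists[of i I] assms by auto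
  obtain l where l: "letter_in_word I (Suc i) l"
    using letter_in_word_exists[of "Suc i" I] assms by auto
  have kl: "k \<le> l" "l < length js"
    using letter_in_word_mono[OF k l] l assms(1) by (auto simp: letter_in_word_def)
  have "splits_after I i \<longleftrightarrow> k \<noteq> l"
    using k l letter_in_word_unique by (metis splits_after_def)
  also have "\<dots> \<longleftrightarrow> js ! k < js ! l"
    using kl assms(2) sorted_wrt_nth_less[of "(<)" js k l] by (cases "k = l") auto
  finally show ?thesis
    using snd_nth_expand[OF assms(1) k] snd_nth_expand[OF assms(1) l] by simp
qed

lemma prod_expand:
  "length I = length js \<Longrightarrow>
    prod_list (map (\<lambda>(a, i). var a i) (expand I js)) = prod_list (map2 xword I js)"
  by (induction I js rule: list_induct2) (auto simp: xword_def comp_def)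

lemma proj_prod_var:
  "proj i (prod_list (map (\<lambda>(a, i). var a i) p)) = map fst (filter (\<lambda>q. snd q = i) p)"
  by (induction p) auto

lemma proj_biword: "map fst (filter (\<lambda>q. snd q = i) (biword m)) = proj i m"
  unfolding proj_prod_var[symmetric] biword_def
  by (simp add: prod_expand length_shape prod_shape)

lemma map_fst_biword: "map fst (biword m) = concat (shape m)"
  by (simp add: biword_def map_fst_expand length_shape)

lemma length_biword: "length (biword m) = length (concat (shape m))"
  by (simp add: biword_def length_expand length_shape)

lemma sorted_biword: "sorted (map snd (biword m))"
  by (simp add: biword_def sorted_expand length_shape sorted_index_list)

lemma snd_biword: "p \<in> set (biword m) \<Longrightarrow> snd p \<in> indices m"
  unfolding biword_def by (auto dest!: snd_expand)

lemma cuts_shape: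
  "cuts (shape m) = {i. 0 < i \<and> i < length (biword m) \<and> snd (biword m ! (i - 1)) < snd (biword m ! i)}"
  by (auto simp: cuts_def length_biword)
    (auto simp: biword_def splits_after_expand length_shape sorted_index_list)

text \<open>Both lists are the stable sort of the same multiset: a sorted list is fixed by the
  sublists of equal key.\<close>

lemma sorted_key_eqI:
  assumes "sorted (map k p)" "sorted (map k q)"
    and "\<And>i. filter (\<lambda>x. k x = i) p = filter (\<lambda>x. k x = i) q"
  shows "p = q"
proof -
  have count: "count (mset p) x = count (mset q) x" for x
  proof -
    have "count (mset r) x = count (mset (filter (\<lambda>y. k y = k x) r)) x" for r
      by simp
    then show ?thesis using assms(3) by metis
  qed
  have "filter (\<lambda>x. k y = k x) p = filter (\<lambda>x. k y = k x) q" for y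
    using assms(3)[of "k y"] by (simp only: eq_commute[of "k y"])
  then have "sort_key k p = q"
    using assms(2) count by (intro properties_for_sort_key multiset_eqI) auto
  moreover have "sort_key k p = p"
    using assms(1) by (intro properties_for_sort_key) auto
  ultimately show ?thesis by simp
qed

lemma biword_unique:
  assumes "sorted (map snd p)" "\<And>i. map fst (filter (\<lambda>q. snd q = i) p) = proj i m"
  shows "p = biword m"
proof (rule sorted_key_eqI[OF assms(1) sorted_biword])
  fix i
  have eq: "filter (\<lambda>q. snd q = i) r = map (\<lambda>c. (c, i)) (map fst (filter (\<lambda>q. snd q = i) r))"
    for r :: "('a \<times> nat) list"
    by (induction r) auto
  show "filter (\<lambda>q. snd q = i) p = filter (\<lambda>q. snd q = i) (biword m)"
    by (subst (1 2) eq) (simp only: assms(2) proj_biword)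
qed

section \<open>Sorting along a relation, linear extensions and descents\<close>

lemma sorted_wrt_unique:
  assumes "asymp R" "sorted_wrt R xs" "sorted_wrt R ys" "set xs = set ys"
  shows "xs = ys"
  using assms(2-)
proof (induction xs arbitrary: ys)
  case (Cons x xs)
  then obtain y zs where ys: "ys = y # zs" by (cases ys) auto
  have irrefl: "\<not> R z z" for z using assms(1) by (meson asympD)
  have "x = y"
  proof (rule ccontr)
    assume "x \<noteq> y"
    then have "x \<in> set zs" "y \<in> set xs" using Cons.prems ys by auto
    then show False using Cons.prems ys assms(1) by (auto dest: asympD)
  qed
  moreover have "x \<notin> set xs" "y \<notin> set zs" using Cons.prems ys irrefl by auto
  ultimately have "set xs = set zs" using Cons.prems ys by auto
  then show ?case using Cons ys \<open>x = y\<close> by auto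
qed simp

text \<open>The number of predecessors in \<open>V\<close> is a numerical key that strictly
  increases along \<open>R\<close>, so sorting by this rank sorts by \<open>R\<close>.\<close>

lemma sorted_wrt_exists:
  assumes "finite V" "asymp R" "transp R" "totalp R"
  shows "\<exists>xs. sorted_wrt R xs \<and> distinct xs \<and> set xs = V"
proof -
  obtain ys where ys: "set ys = V" "distinct ys" using assms(1) finite_distinct_list by auto
  let ?k = "\<lambda>y. card {x \<in> V. R x y}"
  have mono: "?k x < ?k y" if "R x y" "x \<in> V" for x y
  proof (rule psubset_card_mono)
    have "\<not> R x x" using assms(2) by (meson asympD)
    then show "{z \<in> V. R z x} \<subset> {z \<in> V. R z y}"
      using that assms(3) by (auto dest: transpD)
  qed (use assms(1) in auto)
  have "sorted_wrt (\<lambda>x y. ?k x \<le> ?k y \<and> x \<noteq> y) (sort_key ?k ys)"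
    using sorted_sort_key[of ?k ys] ys(2) distinct_sort[of ?k ys]
    by (auto simp: sorted_wrt_iff_nth_less nth_eq_iff_index_eq simp del: distinct_sort)
  then have "sorted_wrt R (sort_key ?k ys)"
  proof (rule sorted_wrt_mono_rel[rotated])
    fix x y assume "x \<in> set (sort_key ?k ys)" "y \<in> set (sort_key ?k ys)" "?k x \<le> ?k y \<and> x \<noteq> y"
    then show "R x y" using mono[of y x] assms(4) ys(1) by (auto dest: totalpD)
  qed
  then show ?thesis using ys by (intro exI[of _ "sort_key ?k ys"]) simp
qed

text \<open>\<open>C\<close> may be any generating relation of the poset, transitive or not: a total
  list that respects \<open>C\<close> also respects its transitive closure.\<close>

definition linear_extensions :: "'b set \<Rightarrow> ('b \<Rightarrow> 'b \<Rightarrow> bool) \<Rightarrow> 'b list set" where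
  "linear_extensions V C = {\<sigma>. distinct \<sigma> \<and> set \<sigma> = V \<and> sorted_wrt (\<lambda>x y. \<not> C y x) \<sigma>}"

text \<open>Demanding this for a poset relation from \<open>x\<close> to \<open>y\<close> is the
  P-partition condition: \<open>f x\<close> is at most \<open>f y\<close>, and strictly less unless
  \<open>B x y\<close>.\<close>

definition key_order :: "('b \<Rightarrow> 'b \<Rightarrow> bool) \<Rightarrow> ('b \<Rightarrow> nat) \<Rightarrow> 'b \<Rightarrow> 'b \<Rightarrow> bool" where
  "key_order B f x y \<longleftrightarrow> f x < f y \<or> f x = f y \<and> B x y"

definition descents :: "('b \<Rightarrow> 'b \<Rightarrow> bool) \<Rightarrow> 'b list \<Rightarrow> nat set" where
  "descents B \<sigma> = {i. 0 < i \<and> i < length \<sigma> \<and> B (\<sigma> ! i) (\<sigma> ! (i - 1))}"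

lemma finite_linear_extensions: "finite V \<Longrightarrow> finite (linear_extensions V C)"
  by (rule finite_subset[OF _ finite_lists_length_eq[of V "card V"]])
    (auto simp: linear_extensions_def distinct_card)

text \<open>Any two different places of the list are comparable under the asymmetric
  \<open>R\<close>, so a relation of \<open>C\<close> either agrees with \<open>R\<close> or runs
  against the list.\<close>

lemma compatible_iff_linear_extension:
  assumes "asymp R" "\<And>x. \<not> C x x" "sorted_wrt R \<sigma>"
  shows "(\<forall>x\<in>set \<sigma>. \<forall>y\<in>set \<sigma>. C x y \<longrightarrow> R x y) \<longleftrightarrow> sorted_wrt (\<lambda>x y. \<not> C y x) \<sigma>"
proof
  assume "\<forall>x\<in>set \<sigma>. \<forall>y\<in>set \<sigma>. C x y \<longrightarrow> R x y"
  then show "sorted_wrt (\<lambda>x y. \<not> C y x) \<sigma>"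
    using assms(1,3) by (auto elim!: sorted_wrt_mono_rel[rotated] dest: asympD)
next
  assume *: "sorted_wrt (\<lambda>x y. \<not> C y x) \<sigma>"
  show "\<forall>x\<in>set \<sigma>. \<forall>y\<in>set \<sigma>. C x y \<longrightarrow> R x y"
  proof (intro ballI impI)
    fix x y assume "x \<in> set \<sigma>" "y \<in> set \<sigma>" "C x y"
    then obtain i j where ij: "i < length \<sigma>" "j < length \<sigma>" "x = \<sigma> ! i" "y = \<sigma> ! j"
      by (metis in_set_conv_nth)
    have "i \<noteq> j" using ij assms(2) \<open>C x y\<close> by auto
    moreover have "\<not> j < i"
      using * ij \<open>C x y\<close> by (auto simp: sorted_wrt_iff_nth_less)
    ultimately show "R x y"
      using assms(3) ij by (auto simp: sorted_wrt_iff_nth_less)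
  qed
qed

text \<open>The fundamental lemma of P-partitions: sorting the elements by value, with ties broken by
  \<open>B\<close>, sends a P-partition to a linear extension, and the fibre over a linear extension consists
  of the weakly increasing value sequences that increase strictly at its descents.\<close>

theorem formal_sum_P_partitions:
  fixes x :: "'t \<Rightarrow> 'a pcmon" and f :: "'t \<Rightarrow> 'b \<Rightarrow> nat" and col :: "'b \<Rightarrow> 'a"
  assumes B: "asymp B" "transp B" "totalp B"
    and C: "\<And>b. \<not> C b b"
    and L: "sorted_wrt B L"
    and proj_x: "\<And>t i. t \<in> X \<Longrightarrow> proj i (x t) = map col (filter (\<lambda>b. f t b = i) L)"
    and pos: "\<And>t b. t \<in> X \<Longrightarrow> b \<in> set L \<Longrightarrow> 0 < f t b"
    and compat: "\<And>t b c. t \<in> X \<Longrightarrow> b \<in> set L \<Longrightarrow> c \<in> set L \<Longrightarrow> C b c \<Longrightarrow> key_order B (f t) b c"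
    and inj: "\<And>t t'. t \<in> X \<Longrightarrow> t' \<in> X \<Longrightarrow> (\<And>b. b \<in> set L \<Longrightarrow> f t b = f t' b) \<Longrightarrow> t = t'"
    and surj: "\<And>g. (\<And>b. b \<in> set L \<Longrightarrow> 0 < g b) \<Longrightarrow>
        (\<And>b c. b \<in> set L \<Longrightarrow> c \<in> set L \<Longrightarrow> C b c \<Longrightarrow> key_order B g b c) \<Longrightarrow>
        \<exists>t\<in>X. \<forall>b\<in>set L. f t b = g b"
  shows "formal_sum X x = (\<Sum>\<sigma>\<in>linear_extensions (set L) C.
      qsym_F (cut_at (map col \<sigma>) (descents B \<sigma>)) :: ('a, 'k::comm_ring_1) series)"
proof
  fix m
  let ?E = "linear_extensions (set L) C"
  let ?I = "\<lambda>\<sigma>. cut_at (map col \<sigma>) (descents B \<sigma>)"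
  let ?S = "{\<sigma> \<in> ?E. 0 \<notin> indices m \<and> refines (shape m) (?I \<sigma>)}"
  have irrefl: "\<not> B b b" for b using B(1) by (meson asympD)
  have R: "asymp (key_order B g)" "transp (key_order B g)" "totalp (key_order B g)" for g
  proof -
    show "asymp (key_order B g)"
      using B(1) by (auto simp: key_order_def intro!: asympI dest: asympD)
    show "transp (key_order B g)"
      using B(2) by (auto simp: key_order_def intro!: transpI dest: transpD)
    show "totalp (key_order B g)"
      using B(3) by (auto simp: key_order_def intro!: totalpI dest: totalpD)
  qed
  define h where "h t = (SOME \<sigma>. sorted_wrt (key_order B (f t)) \<sigma> \<and> distinct \<sigma> \<and> set \<sigma> = set L)" for t
  have h: "sorted_wrt (key_order B (f t)) (h t)" "distinct (h t)" "set (h t) = set L" for t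
    using someI_ex[OF sorted_wrt_exists[OF finite_set[of L] R[of "f t"]]] by (auto simp: h_def)
  \<comment> \<open>Elements of equal value are ordered by \<open>B\<close> in a sorted list, just
    as in \<open>L\<close>. So reading colors along the sorted list gives the same projections as
    reading along \<open>L\<close>.\<close>
  have level: "filter (\<lambda>b. g b = i) \<sigma> = filter (\<lambda>b. g b = i) L"
    if "sorted_wrt (key_order B g) \<sigma>" "set \<sigma> = set L" for g \<sigma> i
  proof (rule sorted_wrt_unique[OF B(1)])
    have "sorted_wrt (key_order B g) (filter (\<lambda>b. g b = i) \<sigma>)"
      using that by (intro sorted_wrt_filter)
    then show "sorted_wrt B (filter (\<lambda>b. g b = i) \<sigma>)"
      by (rule sorted_wrt_mono_rel[rotated]) (auto simp: key_order_def)
  qed (use L that in \<open>auto intro: sorted_wrt_filter\<close>)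
  have biword: "map (\<lambda>b. (col b, f t b)) (h t) = biword (x t)" if "t \<in> X" for t
  proof (rule biword_unique)
    show "sorted (map snd (map (\<lambda>b. (col b, f t b)) (h t)))"
      unfolding sorted_wrt_map map_map
      by (rule sorted_wrt_mono_rel[OF _ h(1)]) (auto simp: key_order_def)
    show "map fst (filter (\<lambda>q. snd q = i) (map (\<lambda>b. (col b, f t b)) (h t))) = proj i (x t)" for i
      using level[OF h(1,3), of t i] proj_x[OF that, of i] by (simp add: filter_map comp_def)
  qed
  have "bij_betw h {t \<in> X. x t = m} ?S"
  proof (rule bij_betw_imageI)
    show "inj_on h {t \<in> X. x t = m}"
    proof (intro inj_onI inj)
      fix t t' b
      assume t: "t \<in> {t \<in> X. x t = m}" and t': "t' \<in> {t \<in> X. x t = m}"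
        and eq: "h t = h t'" and b: "b \<in> set L"
      have "map (\<lambda>b. (col b, f t b)) (h t) = map (\<lambda>b. (col b, f t' b)) (h t)"
        using biword[of t] biword[of t'] t t' eq by simp
      then show "f t b = f t' b" using b h(3)[of t] by auto
    qed auto
    show "h ` {t \<in> X. x t = m} = ?S"
    proof (intro equalityI subsetI)
      fix \<sigma> assume "\<sigma> \<in> h ` {t \<in> X. x t = m}"
      then obtain t where t: "t \<in> X" "x t = m" "\<sigma> = h t" by auto
      have bi: "biword m = map (\<lambda>b. (col b, f t b)) \<sigma>" using biword[of t] t by simp
      have w: "map col \<sigma> = concat (shape m)"
        using map_fst_biword[of m] by (simp add: bi comp_def)
      have "filter (\<lambda>b. f t b = 0) L = []"
        using pos[OF t(1)] by (auto simp: filter_empty_conv)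
      then have "proj 0 m = []"
        using proj_x[OF t(1), of 0] t(2) by simp
      then have "0 \<notin> indices m" by (simp add: indices_iff_proj)
      moreover have "\<sigma> \<in> ?E"
        using compatible_iff_linear_extension[of "key_order B (f t)" C "h t", OF R(1) C h(1)] h[of t] compat[OF t(1)] t(3)
        by (auto simp: linear_extensions_def)
      moreover have "descents B \<sigma> \<subseteq> cuts (shape m)"
      proof
        fix i assume i: "i \<in> descents B \<sigma>"
        then have "key_order B (f t) (\<sigma> ! (i - 1)) (\<sigma> ! i)"
          using h(1)[of t] t(3) by (auto simp: descents_def sorted_wrt_iff_nth_less)
        \<comment> \<open>A descent excludes a tie, since ties are ordered by
          \<open>B\<close>.\<close>
        then have "f t (\<sigma> ! (i - 1)) < f t (\<sigma> ! i)"
          using i B(1) by (auto simp: key_order_def descents_def dest: asympD)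
        then show "i \<in> cuts (shape m)"
          using i less_imp_diff_less[of i "length \<sigma>" 1] by (simp add: cuts_shape bi descents_def)
      qed
      ultimately show "\<sigma> \<in> ?S"
        using w by (auto simp: refines_iff_cuts Nil_notin_shape Nil_notin_cut_at)
    next
      fix \<sigma> assume \<sigma>: "\<sigma> \<in> ?S"
      then have dist: "distinct \<sigma>" and set: "set \<sigma> = set L"
        and w: "map col \<sigma> = concat (shape m)" and des: "descents B \<sigma> \<subseteq> cuts (shape m)"
        by (auto simp: linear_extensions_def refines_iff_cuts Nil_notin_shape Nil_notin_cut_at
            descents_def)
      \<comment> \<open>The inverse of sorting: the element at place \<open>i\<close> of the linear
        extension receives the index at place \<open>i\<close> of the biword as its value
        \<open>g\<close>.\<close>
      define p where "p = biword m"
      have len: "length p = length \<sigma>"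
        using w length_biword[of m] by (metis length_map p_def)
      define g where "g b = the (map_of (zip \<sigma> (map snd p)) b)" for b
      have g: "g (\<sigma> ! i) = snd (p ! i)" if "i < length \<sigma>" for i
        using that dist len by (simp add: g_def map_of_zip_nth)
      have p: "map (\<lambda>b. (col b, g b)) \<sigma> = p"
      proof (rule nth_equalityI)
        fix i assume i: "i < length (map (\<lambda>b. (col b, g b)) \<sigma>)"
        have "map col \<sigma> = map fst p" using w map_fst_biword[of m] by (simp add: p_def)
        then have "col (\<sigma> ! i) = fst (p ! i)" using i len by (metis length_map nth_map)
        then show "map (\<lambda>b. (col b, g b)) \<sigma> ! i = p ! i" using i g by simp
      qed (simp add: len)
      have sorted: "sorted_wrt (key_order B g) \<sigma>"
        unfolding sorted_wrt_iff_nth_Suc_transp[OF R(2)]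
      proof (intro allI impI)
        fix i assume i: "Suc i < length \<sigma>"
        have le: "g (\<sigma> ! i) \<le> g (\<sigma> ! Suc i)"
          using sorted_biword[of m] i len g by (simp add: sorted_wrt_iff_nth_less flip: p_def)
        \<comment> \<open>Equal values at neighbours mean no cut between them, hence no
          descent.\<close>
        moreover have "B (\<sigma> ! i) (\<sigma> ! Suc i)" if "g (\<sigma> ! i) = g (\<sigma> ! Suc i)"
        proof -
          have "Suc i \<notin> cuts (shape m)"
            using that i g len by (simp add: cuts_shape flip: p_def)
          then have "\<not> B (\<sigma> ! Suc i) (\<sigma> ! i)"
            using des i by (auto simp: descents_def)
          moreover have "\<sigma> ! i \<noteq> \<sigma> ! Suc i"
            using dist i by (simp add: nth_eq_iff_index_eq)
          ultimately show ?thesis using B(3) by (auto dest: totalpD)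
        qed
        ultimately show "key_order B g (\<sigma> ! i) (\<sigma> ! Suc i)"
          by (auto simp: key_order_def)
      qed
      have "\<exists>t\<in>X. \<forall>b\<in>set L. f t b = g b"
      proof (rule surj)
        fix b assume "b \<in> set L"
        then have "(col b, g b) \<in> set p" using set p by force
        then have "g b \<in> indices m" using snd_biword[of _ m] by (auto simp: p_def)
        then show "0 < g b" using \<sigma> by (cases "g b") auto
      next
        fix b c assume "b \<in> set L" "c \<in> set L" "C b c"
        then show "key_order B g b c"
          using compatible_iff_linear_extension[of "key_order B g" C \<sigma>, OF R(1) C sorted] \<sigma> set
          by (auto simp: linear_extensions_def)
      qed
      then obtain t where t: "t \<in> X" "\<And>b. b \<in> set L \<Longrightarrow> f t b = g b" by blast
      have sorted_t: "sorted_wrt (key_order B (f t)) \<sigma>"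
        by (rule sorted_wrt_mono_rel[OF _ sorted]) (simp add: key_order_def t(2) set)
      then have "h t = \<sigma>"
        using sorted_wrt_unique[OF R(1) h(1)] h(3) set by metis
      moreover have "x t = m"
      proof (rule pcmon_eqI)
        fix i
        have "map (\<lambda>b. (col b, f t b)) \<sigma> = p"
          using p t(2) set by (metis (no_types, lifting) map_eq_conv)
        then show "proj i (x t) = proj i m"
          using biword[OF t(1)] \<open>h t = \<sigma>\<close> by (metis p_def proj_biword)
      qed
      ultimately show "\<sigma> \<in> h ` {t \<in> X. x t = m}" using t by blast
    qed
  qed
  then have card: "card {t \<in> X. x t = m} = card ?S" by (rule bij_betw_same_card)
  have sum_apply: "(\<Sum>\<sigma>\<in>T. F \<sigma>) m = (\<Sum>\<sigma>\<in>T. F \<sigma> m)" if "finite T"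
    for T and F :: "'b list \<Rightarrow> ('a, 'k) series"
    using that by (induction T rule: finite_induct) auto
  have fin: "finite ?E" by (rule finite_linear_extensions) simp
  have "(\<Sum>\<sigma>\<in>?E. qsym_F (?I \<sigma>)) m = (\<Sum>\<sigma>\<in>?E. of_bool (0 \<notin> indices m \<and> refines (shape m) (?I \<sigma>)) :: 'k)"
    by (simp add: sum_apply fin qsym_F_eq)
  also have "\<dots> = of_nat (card ?S)"
    using fin by (simp add: Int_def)
  finally show "formal_sum X x m = (\<Sum>\<sigma>\<in>?E. qsym_F (?I \<sigma>) :: ('a, 'k) series) m"
    by (simp add: formal_sum_def card)
qed

text \<open>Neighbours in a distinct list are comparable under \<open>B\<close> in exactly one
  direction, so each interior position is a descent for exactly one of the two orders.\<close>

lemma complement_cut_descents: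
  assumes "asymp B" "totalp B" "distinct \<sigma>"
  shows "complement (cut_at (map col \<sigma>) (descents B \<sigma>)) = cut_at (map col \<sigma>) (descents (\<lambda>x y. B y x) \<sigma>)"
proof (rule sentence_eqI)
  have "B (\<sigma> ! i) (\<sigma> ! (i - 1)) \<longleftrightarrow> \<not> B (\<sigma> ! (i - 1)) (\<sigma> ! i)" if "0 < i" "i < length \<sigma>" for i
  proof -
    have "\<sigma> ! i \<noteq> \<sigma> ! (i - 1)" using assms(3) that by (simp add: nth_eq_iff_index_eq)
    then show ?thesis using assms(1,2) by (auto dest: asympD totalpD)
  qed
  then show "cuts (complement (cut_at (map col \<sigma>) (descents B \<sigma>)))
      = cuts (cut_at (map col \<sigma>) (descents (\<lambda>x y. B y x) \<sigma>))"
    by (auto simp: complement_eq Nil_notin_cut_at descents_def)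
qed (simp_all add: complement_eq Nil_notin_cut_at)

section \<open>Immaculate tableaux as P-partitions\<close>

definition row_boxes :: "'a list list \<Rightarrow> nat \<Rightarrow> (nat \<times> nat) list" where
  "row_boxes J r = map (Pair r) [0..<length (J ! r)]"

definition reading :: "'a list list \<Rightarrow> (nat \<times> nat) list" where
  "reading J = concat (rev (map (row_boxes J) [0..<length J]))"

text \<open>The labelling order of immaculate tableaux. A box precedes those to its right, so ties
  are allowed in rows; it follows those below it, so ties are forbidden in the first column.\<close>

definition read_before :: "nat \<times> nat \<Rightarrow> nat \<times> nat \<Rightarrow> bool" where
  "read_before b b' \<longleftrightarrow> fst b' < fst b \<or> fst b = fst b' \<and> snd b < snd b'"

text \<open>Not transitive: a box of the first column is not related to the later boxes of lower
  rows, although the generated poset relates them.\<close>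

definition tableau_order :: "nat \<times> nat \<Rightarrow> nat \<times> nat \<Rightarrow> bool" where
  "tableau_order b b' \<longleftrightarrow>
     fst b = fst b' \<and> snd b < snd b' \<or> snd b = 0 \<and> snd b' = 0 \<and> fst b < fst b'"

abbreviation entry :: "'c list list \<Rightarrow> nat \<times> nat \<Rightarrow> 'c" where
  "entry T b \<equiv> T ! fst b ! snd b"

lemma read_before:
  shows asymp_read_before: "asymp read_before"
    and transp_read_before: "transp read_before"
    and totalp_read_before: "totalp read_before"
  by (auto simp: read_before_def prod_eq_iff intro!: asympI transpI totalpI)

lemma set_reading: "set (reading J) = {b. fst b < length J \<and> snd b < length (J ! fst b)}"
  by (auto simp: reading_def row_boxes_def)

lemma sorted_reading: "sorted_wrt read_before (reading J)"
proof -
  have "sorted_wrt read_before (concat (rev (map (row_boxes J) [0..<n])))" for n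
    by (induction n)
      (auto simp: sorted_wrt_append row_boxes_def read_before_def sorted_wrt_map
        intro!: sorted_wrt_mono_rel[OF _ sorted_wrt_upt])
  then show ?thesis by (simp add: reading_def)
qed

lemma fillings_iff:
  "T \<in> fillings J \<longleftrightarrow> length T = length J \<and> (\<forall>r<length J. length (T ! r) = length (J ! r)) \<and>
     (\<forall>b\<in>set (reading J). 1 \<le> entry T b)"
proof -
  have "map length T = map length J \<longleftrightarrow>
      length T = length J \<and> (\<forall>r<length J. length (T ! r) = length (J ! r))"
    by (auto simp: list_eq_iff_nth_eq)
  then show ?thesis
    by (auto simp: fillings_def set_reading all_set_conv_all_nth)
qed

lemma set_concat_filling:
  assumes "T \<in> fillings J"
  shows "set (concat T) = entry T ` set (reading J)"
proof (intro equalityI subsetI)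
  fix e assume "e \<in> set (concat T)"
  then obtain r c where "r < length T" "c < length (T ! r)" "e = T ! r ! c"
    by (auto simp: in_set_conv_nth)
  then have "(r, c) \<in> set (reading J)" "e = entry T (r, c)"
    using assms by (auto simp: fillings_iff set_reading)
  then show "e \<in> entry T ` set (reading J)" by blast
next
  fix e assume "e \<in> entry T ` set (reading J)"
  then obtain b where "fst b < length T" "snd b < length (T ! fst b)" "e = entry T b"
    using assms by (auto simp: fillings_iff set_reading)
  then show "e \<in> set (concat T)" by (auto intro!: bexI[of _ "T ! fst b"])
qed

lemma row_colors_eq:
  assumes "length (T ! r) = length (J ! r)"
  shows "row_colors i (J ! r) (T ! r) = map (entry J) (filter (\<lambda>b. entry T b = i) (row_boxes J r))"
proof -
  have "zip (J ! r) (T ! r) = map (\<lambda>c. (J ! r ! c, T ! r ! c)) [0..<length (J ! r)]"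
    using assms by (intro nth_equalityI) auto
  then show ?thesis
    by (simp add: row_colors_def row_boxes_def filter_map comp_def)
qed

lemma map2_row_colors:
  assumes "T \<in> fillings J"
  shows "map2 (row_colors i) J T
    = map (\<lambda>r. map (entry J) (filter (\<lambda>b. entry T b = i) (row_boxes J r))) [0..<length J]"
  using assms by (intro nth_equalityI) (auto simp: fillings_iff row_colors_eq)

lemma CIT_type_eq:
  assumes "T \<in> fillings J"
  shows "CIT_type J T i = map (entry J) (filter (\<lambda>b. entry T b = i) (reading J))"
  by (simp add: CIT_type_def map2_row_colors[OF assms] reading_def filter_concat map_concat rev_map comp_def)

lemma rev_subsingleton:
  assumes "\<And>x y. x \<in> set xs \<Longrightarrow> y \<in> set xs \<Longrightarrow> x = y" "distinct xs"
  shows "rev xs = xs"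
\<comment> \<open>This rule merely separates lists of length 0, 1 and at least 2.\<close>
proof (cases xs rule: remdups_adj.cases)
  case (3 x y ys)
  then show ?thesis using assms(1)[of x y] assms(2) by simp
qed simp_all

text \<open>The rows of a row-strict tableau have distinct entries, so each row may be read backwards.\<close>

lemma CRSIT_type_eq:
  assumes "T \<in> fillings J" "\<forall>r\<in>set T. sorted_wrt (<) r"
  shows "CRSIT_type J T i = map (entry J) (filter (\<lambda>b. entry T b = i) (rev (reading J)))"
proof -
  have "filter (\<lambda>b. entry T b = i) (rev (row_boxes J r)) = filter (\<lambda>b. entry T b = i) (row_boxes J r)"
    (is "_ = ?xs") if r: "r < length J" for r
  proof -
    have "b = b'" if "b \<in> set ?xs" "b' \<in> set ?xs" for b b'
    proof -
      have "T ! r \<in> set T" using r assms(1) by (simp add: fillings_iff)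
      then have "distinct (T ! r)" using assms(2) by (auto simp: strict_sorted_iff)
      then show ?thesis
        using that r assms(1) by (auto simp: row_boxes_def fillings_iff nth_eq_iff_index_eq)
    qed
    moreover have "distinct ?xs" by (auto simp: row_boxes_def distinct_map inj_on_def)
    ultimately have "rev ?xs = ?xs"
      by (intro rev_subsingleton)
    then show ?thesis by (simp only: rev_filter)
  qed
  note row = this
  have "rev (reading J) = concat (map (\<lambda>r. rev (row_boxes J r)) [0..<length J])"
    by (simp add: reading_def rev_concat comp_def del: rev_map)
  then have "map (entry J) (filter (\<lambda>b. entry T b = i) (rev (reading J)))
      = concat (map (\<lambda>r. map (entry J) (filter (\<lambda>b. entry T b = i) (rev (row_boxes J r)))) [0..<length J])"
    by (simp add: filter_concat map_concat comp_def)
  also have "\<dots> = concat (map (\<lambda>r. map (entry J) (filter (\<lambda>b. entry T b = i) (row_boxes J r))) [0..<length J])"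
    by (intro arg_cong[of _ _ concat] map_cong refl) (simp add: row)
  finally show ?thesis
    by (simp add: CRSIT_type_def map2_row_colors[OF assms(1)])
qed

section \<open>Tableau monomials and compatible fillings\<close>

lemma proj_type_monomial:
  "proj i (type_monomial u n) = (if 1 \<le> i \<and> i \<le> n then u i else [])"
proof (induction n)
  case 0
  show ?case by (auto simp: type_monomial_def)
next
  case (Suc n)
  have "type_monomial u (Suc n) = type_monomial u n * xword (u (Suc n)) (Suc n)"
    by (simp add: type_monomial_def)
  then show ?case using Suc by auto
qed

text \<open>P-partitions with labelling order \<open>B\<close>: for nonempty rows,
  \<open>read_before\<close> yields the immaculate tableaux and its reverse the row-strict
  ones.\<close>

definition compatible_fillings :: "(nat \<times> nat \<Rightarrow> nat \<times> nat \<Rightarrow> bool) \<Rightarrow> 'a list list \<Rightarrow> nat list list set" where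
  "compatible_fillings B J = {T \<in> fillings J. \<forall>b\<in>set (reading J). \<forall>b'\<in>set (reading J).
     tableau_order b b' \<longrightarrow> key_order B (entry T) b b'}"

lemma formal_sum_fillings:
  fixes J :: "'a list list"
  assumes B: "asymp B" "transp B" "totalp B"
    and L: "sorted_wrt B L" "set L = set (reading J)"
    and u: "\<And>T i. T \<in> compatible_fillings B J \<Longrightarrow>
      u T i = map (entry J) (filter (\<lambda>b. entry T b = i) L)"
  shows "formal_sum (compatible_fillings B J) (\<lambda>T. type_monomial (u T) (max_entry T))
    = (\<Sum>\<sigma>\<in>linear_extensions (set (reading J)) tableau_order.
        qsym_F (cut_at (map (entry J) \<sigma>) (descents B \<sigma>)) :: ('a, 'k::comm_ring_1) series)"
  unfolding L(2)[symmetric]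
proof (rule formal_sum_P_partitions[where f = entry, OF B _ L(1)])
  show "\<not> tableau_order b b" for b by (simp add: tableau_order_def)
next
  fix T i assume T: "T \<in> compatible_fillings B J"
  then have fill: "T \<in> fillings J" by (simp add: compatible_fillings_def)
  \<comment> \<open>The monomial only multiplies the indices from 1 to the largest entry; no box
    carries a value outside that range.\<close>
  have "filter (\<lambda>b. entry T b = i) L = []" if "\<not> (1 \<le> i \<and> i \<le> max_entry T)"
  proof -
    have "1 \<le> entry T b \<and> entry T b \<le> max_entry T" if "b \<in> set L" for b
    proof
      show "1 \<le> entry T b" using that fill L(2) by (auto simp: fillings_iff)
      have "entry T b \<in> set (concat T)" using that set_concat_filling[OF fill] L(2) by auto
      then show "entry T b \<le> max_entry T" unfolding max_entry_def by (intro Max_ge) auto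
    qed
    then show ?thesis using that by (auto simp: filter_empty_conv)
  qed
  then show "proj i (type_monomial (u T) (max_entry T))
      = map (entry J) (filter (\<lambda>b. entry T b = i) L)"
    using u[OF T, of i] by (auto simp: proj_type_monomial)
next
  fix T b assume "T \<in> compatible_fillings B J" "b \<in> set L"
  then show "0 < entry T b"
    using L(2) by (auto simp: compatible_fillings_def fillings_iff Suc_le_eq)
next
  fix T b c assume "T \<in> compatible_fillings B J" "b \<in> set L" "c \<in> set L" "tableau_order b c"
  then show "key_order B (entry T) b c"
    using L(2) by (simp add: compatible_fillings_def)
next
  fix T T' assume T: "T \<in> compatible_fillings B J" "T' \<in> compatible_fillings B J"
    and eq: "\<And>b. b \<in> set L \<Longrightarrow> entry T b = entry T' b"
  have "T ! r = T' ! r" if "r < length J" for r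
    using T that eq[of "(r, _)"] L(2)
    by (intro nth_equalityI) (auto simp: compatible_fillings_def fillings_iff set_reading)
  then show "T = T'"
    using T by (intro nth_equalityI) (auto simp: compatible_fillings_def fillings_iff)
next
  fix g :: "nat \<times> nat \<Rightarrow> nat"
  assume pos: "\<And>b. b \<in> set L \<Longrightarrow> 0 < g b"
    and compat: "\<And>b c. b \<in> set L \<Longrightarrow> c \<in> set L \<Longrightarrow> tableau_order b c \<Longrightarrow> key_order B g b c"
  \<comment> \<open>The tableau whose entries are the values of \<open>g\<close>.\<close>
  let ?T = "map (\<lambda>r. map (\<lambda>c. g (r, c)) [0..<length (J ! r)]) [0..<length J]"
  have entry: "entry ?T b = g b" if "b \<in> set L" for b
    using that L(2) by (auto simp: set_reading)
  have "?T \<in> compatible_fillings B J"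
    using pos compat entry L(2)
    by (auto simp: compatible_fillings_def fillings_iff key_order_def Suc_le_eq
        simp del: nth_map length_map) auto
  then show "\<exists>T\<in>compatible_fillings B J. \<forall>b\<in>set L. entry T b = g b"
    using entry by blast
qed

text \<open>Separates the row conditions from the first-column conditions, to be matched with the
  two sortedness requirements on tableaux. The box \<open>(r, 0)\<close> exists only in a nonempty
  row.\<close>

lemma ball_reading:
  "(\<forall>b\<in>set (reading J). \<forall>b'\<in>set (reading J). tableau_order b b' \<longrightarrow> P b b') \<longleftrightarrow>
    (\<forall>r<length J. \<forall>c c'. c < c' \<and> c' < length (J ! r) \<longrightarrow> P (r, c) (r, c')) \<and>
    (\<forall>r r'. r < r' \<and> r' < length J \<and> J ! r \<noteq> [] \<and> J ! r' \<noteq> [] \<longrightarrow> P (r, 0) (r', 0))"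
  (is "?L \<longleftrightarrow> ?R")
proof
  assume L: ?L
  show ?R
  proof (intro conjI allI impI)
    fix r c c' assume "r < length J" "c < c' \<and> c' < length (J ! r)"
    then show "P (r, c) (r, c')"
      using L[rule_format, of "(r, c)" "(r, c')"] by (simp add: set_reading tableau_order_def)
  next
    fix r r' assume "r < r' \<and> r' < length J \<and> J ! r \<noteq> [] \<and> J ! r' \<noteq> []"
    then show "P (r, 0) (r', 0)"
      using L[rule_format, of "(r, 0)" "(r', 0)"] by (simp add: set_reading tableau_order_def)
  qed
qed (auto simp: set_reading tableau_order_def)

lemma sorted_rows_iff:
  assumes "T \<in> fillings J"
  shows "(\<forall>r\<in>set T. sorted_wrt R r) \<longleftrightarrow>
    (\<forall>r<length J. \<forall>c c'. c < c' \<and> c' < length (J ! r) \<longrightarrow> R (T ! r ! c) (T ! r ! c'))"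
  using assms by (auto simp: fillings_iff all_set_conv_all_nth sorted_wrt_iff_nth_less)

text \<open>Nonempty words make every row nonempty, so that \<open>hd\<close> really is the entry in
  column 0.\<close>

lemma sorted_first_column_iff:
  assumes "T \<in> fillings J" "[] \<notin> set J"
  shows "sorted_wrt R (map hd T) \<longleftrightarrow>
    (\<forall>r r'. r < r' \<and> r' < length J \<and> J ! r \<noteq> [] \<and> J ! r' \<noteq> [] \<longrightarrow> R (T ! r ! 0) (T ! r' ! 0))"
proof -
  have ne: "J ! r \<noteq> []" if "r < length J" for r
    using assms(2) that by (metis nth_mem)
  have "hd (T ! r) = T ! r ! 0" if "r < length J" for r
  proof -
    have "length (T ! r) = length (J ! r)" using assms(1) that by (simp add: fillings_iff)
    then have "T ! r \<noteq> []" using ne[OF that] by auto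
    then show ?thesis by (rule hd_conv_nth)
  qed
  then show ?thesis
    using assms(1) ne by (auto simp: fillings_iff sorted_wrt_iff_nth_less)
qed

text \<open>Within a row the tie clause of \<open>key_order\<close> always holds, leaving a weak
  inequality; down the first column it always fails, leaving a strict one. For
  \<open>CRSIT_eq\<close> the roles are exchanged.\<close>

lemma CIT_eq:
  assumes "[] \<notin> set J"
  shows "CIT J = compatible_fillings read_before J"
  unfolding CIT_def compatible_fillings_def ball_reading using assms
  by (intro Collect_cong conj_cong refl)
    (auto simp: sorted_rows_iff sorted_first_column_iff key_order_def read_before_def le_less)

lemma CRSIT_eq:
  assumes "[] \<notin> set J"
  shows "CRSIT J = compatible_fillings (\<lambda>b b'. read_before b' b) J"
  unfolding CRSIT_def compatible_fillings_def ball_reading using assms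
  by (intro Collect_cong conj_cong refl)
    (auto simp: sorted_rows_iff sorted_first_column_iff key_order_def read_before_def le_less)

theorem theorem7p23:
  fixes A :: "'a set" and J :: "'a list list"
  assumes "finite A" and "J \<in> sentences A"
  shows "qsym_psi A (dual_immaculate J :: ('a, 'k::comm_ring_1) series)
       = row_strict_dual_immaculate J"
proof -
  have ne: "[] \<notin> set J" and colors: "set (concat J) \<subseteq> A"
    using assms(2) by (simp_all add: sentences_iff)
  let ?E = "linear_extensions (set (reading J)) tableau_order"
  let ?I = "\<lambda>\<sigma>. cut_at (map (entry J) \<sigma>) (descents read_before \<sigma>)"
  let ?after = "\<lambda>b b'. read_before b' b"
  have after: "asymp ?after" "transp ?after" "totalp ?after"
    using asympD[OF asymp_read_before] transpD[OF transp_read_before] totalpD[OF totalp_read_before]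
    by (blast intro: asympI transpI totalpI)+
  have dual: "dual_immaculate J = (\<Sum>\<sigma>\<in>?E. qsym_F (?I \<sigma>) :: ('a, 'k) series)"
    unfolding dual_immaculate_def CIT_eq[OF ne]
    by (rule formal_sum_fillings[OF read_before sorted_reading refl])
      (simp add: CIT_type_eq compatible_fillings_def)
  have row_strict: "row_strict_dual_immaculate J
      = (\<Sum>\<sigma>\<in>?E. qsym_F (cut_at (map (entry J) \<sigma>) (descents ?after \<sigma>)) :: ('a, 'k) series)"
    unfolding row_strict_dual_immaculate_def CRSIT_eq[OF ne]
  proof (rule formal_sum_fillings[OF after])
    show "sorted_wrt ?after (rev (reading J))"
      using sorted_reading by (simp add: sorted_wrt_rev)
    show "CRSIT_type J T i = map (entry J) (filter (\<lambda>b. entry T b = i) (rev (reading J)))"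
      if "T \<in> compatible_fillings ?after J" for T i
      using that CRSIT_type_eq[of T J i] unfolding CRSIT_eq[OF ne, symmetric] CRSIT_def by blast
  qed simp
  \<comment> \<open>The values of psi are prescribed only for sentences over \<open>A\<close>, so
    the colors of the boxes must be traced back to \<open>A\<close>.\<close>
  have sent: "?I \<sigma> \<in> sentences A" if "\<sigma> \<in> ?E" for \<sigma>
  proof -
    have "entry J b \<in> A" if "b \<in> set (reading J)" for b
    proof -
      have "entry J b \<in> set (concat J)" using that by (force simp: set_reading in_set_conv_nth)
      then show ?thesis using colors by blast
    qed
    then show ?thesis using that
      unfolding sentences_iff concat_cut_at by (auto simp: Nil_notin_cut_at linear_extensions_def)
  qed
  have fin: "finite ?E" by (simp add: finite_linear_extensions)
  have "qsym_psi A (dual_immaculate J) = (\<Sum>\<sigma>\<in>?E. qsym_F (complement (?I \<sigma>)) :: ('a, 'k) series)"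
    unfolding dual using fin sent by (rule qsym_psi_sum_F)
  also have "\<dots> = (\<Sum>\<sigma>\<in>?E. qsym_F (cut_at (map (entry J) \<sigma>) (descents ?after \<sigma>)))"
  proof (rule sum.cong[OF refl])
    fix \<sigma> assume "\<sigma> \<in> ?E"
    then have "distinct \<sigma>" by (simp add: linear_extensions_def)
    from complement_cut_descents[OF asymp_read_before totalp_read_before this]
    show "qsym_F (complement (?I \<sigma>)) = (qsym_F (cut_at (map (entry J) \<sigma>) (descents ?after \<sigma>)) :: ('a, 'k) series)"
      by (rule arg_cong)
  qed
  finally show ?thesis using row_strict by simp
qed

end
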